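(* Let $M$ be a separable complete pointed metric space containing more than one point, and let $f\colon M\to M$ be a topologically transitive Lipschitz mapping fixing the base point of $M$. Let $S_f\colon \mathcal{F}(M,\mathbb{C})\to\mathcal{F}(M,\mathbb{C})$ be the complex Lipschitz operator induced by $f$. Then every connected component of the spectrum $\sigma(S_f)\subset\mathbb{C}$ intersects the unit circle $\mathbb{T}=\{z\in\mathbb{C}\colon |z|=1\}$.
   Context: A pointed metric space is a metric space $(M,d)$ with a distinguished base point $0_M\in M$ (also written $0$). A continuous map $f\colon M\to M$ is topologically transitive if for every pair of non-empty open sets $U,V\subset M$ there is $n\in\mathbb{N}=\{1,2,\dots\}$ with $f^n(U)\cap V\neq\emptyset$. $\operatorname{Lip}_0(M,\mathbb{C})$ is the Banach space of Lipschitz functions $g\colon M\to\mathbb{C}$ with $g(0_M)=0$, with norm equal to the Lipschitz constant $\operatorname{Lip}(g)$. For $x\in M$, $\delta_x\in \operatorname{Lip}_0(M,\mathbb{C})^*$ is evaluation at $x$. The complex Lipschitz-free space $\mathcal{F}(M,\mathbb{C})$ is the closed complex linear span of $\{\delta_x\colon x\in M\}$ in $\operatorname{Lip}_0(M,\mathbb{C})^*$, with the induced norm. For a Lipschitz map $f\colon M\to M$ with $f(0_M)=0_M$, $S_f\colon\mathcal{F}(M,\mathbb{C})\to\mathcal{F}(M,\mathbb{C})$ is the unique bounded complex-linear operator with $S_f(\delta_x)=\delta_{f(x)}$ for all $x\in M$. *)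

theory Defs
  imports "HOL-Analysis.Analysis"
begin

section \<open>Complex normed spaces\<close>

class scaleC =
  fixes scaleC :: "complex \<Rightarrow> 'a \<Rightarrow> 'a"  (infixr \<open>*\<^sub>C\<close> 75)

class complex_normed_vector = real_normed_vector + scaleC +
  assumes scaleC_add_right: "a *\<^sub>C (x + y) = a *\<^sub>C x + a *\<^sub>C y"
    and scaleC_add_left: "(a + b) *\<^sub>C x = a *\<^sub>C x + b *\<^sub>C x"
    and scaleC_scaleC: "a *\<^sub>C b *\<^sub>C x = (a * b) *\<^sub>C x"
    and scaleR_scaleC: "r *\<^sub>R x = complex_of_real r *\<^sub>C x"
    and norm_scaleC: "norm (a *\<^sub>C x) = cmod a * norm x"

lemma scaleC_one: "1 *\<^sub>C x = (x :: 'a :: complex_normed_vector)"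
  using scaleR_scaleC[of 1 x] by simp

global_interpretation complex_vector:
  vector_space "scaleC :: complex \<Rightarrow> 'a \<Rightarrow> 'a :: complex_normed_vector"
  defines cspan = complex_vector.span
    and csubspace = complex_vector.subspace
  by unfold_locales (simp_all add: scaleC_add_right scaleC_add_left scaleC_scaleC scaleC_one)

abbreviation clinear :: "('a :: complex_normed_vector \<Rightarrow> 'b :: complex_normed_vector) \<Rightarrow> bool"
  where "clinear \<equiv> Vector_Spaces.linear scaleC scaleC"

lemma clinearI:
  fixes f :: "'a :: complex_normed_vector \<Rightarrow> 'b :: complex_normed_vector"
  assumes "\<And>x y. f (x + y) = f x + f y" "\<And>c x. f (c *\<^sub>C x) = c *\<^sub>C f x"
  shows "clinear f"
  unfolding Vector_Spaces.linear_def module_hom_def module_hom_axioms_def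
  by (simp add: assms complex_vector.vector_space_axioms complex_vector.module_axioms)

lemma clinearD:
  fixes f :: "'a :: complex_normed_vector \<Rightarrow> 'b :: complex_normed_vector"
  assumes "clinear f"
  shows "f (x + y) = f x + f y" "f (c *\<^sub>C x) = c *\<^sub>C f x"
  using assms by (auto simp: Vector_Spaces.linear_def module_hom_def module_hom_axioms_def)

instantiation complex :: complex_normed_vector
begin

definition scaleC_complex :: "complex \<Rightarrow> complex \<Rightarrow> complex"
  where "scaleC_complex c z = c * z"

instance
  by standard (simp_all add: scaleC_complex_def algebra_simps norm_mult scaleR_conv_of_real)

end

lemma bounded_linear_scaleC: "bounded_linear (\<lambda>x :: 'a :: complex_normed_vector. c *\<^sub>C x)"
proof (rule bounded_linear_intro[where K = "cmod c"])
  show "c *\<^sub>C r *\<^sub>R x = r *\<^sub>R c *\<^sub>C x" for r and x :: 'a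
    by (simp add: scaleR_scaleC scaleC_scaleC mult.commute)
qed (simp_all add: scaleC_add_right norm_scaleC mult.commute)

instantiation blinfun :: (real_normed_vector, complex_normed_vector) complex_normed_vector
begin

lift_definition scaleC_blinfun :: "complex \<Rightarrow> 'a \<Rightarrow>\<^sub>L 'b \<Rightarrow> 'a \<Rightarrow>\<^sub>L 'b"
  is "\<lambda>c T x. c *\<^sub>C T x"
  by (rule bounded_linear_compose[OF bounded_linear_scaleC])

instance
proof
  fix a b :: complex and r :: real and S T :: "'a \<Rightarrow>\<^sub>L 'b"
  show "a *\<^sub>C (S + T) = a *\<^sub>C S + a *\<^sub>C T"
    by transfer (simp add: scaleC_add_right)
  show "(a + b) *\<^sub>C T = a *\<^sub>C T + b *\<^sub>C T"
    by transfer (simp add: scaleC_add_left)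
  show "a *\<^sub>C b *\<^sub>C T = (a * b) *\<^sub>C T"
    by transfer (simp add: scaleC_scaleC)
  show "r *\<^sub>R T = complex_of_real r *\<^sub>C T"
    by transfer (simp add: scaleR_scaleC)
  have le: "norm (c *\<^sub>C U) \<le> cmod c * norm U" for c :: complex and U :: "'a \<Rightarrow>\<^sub>L 'b"
    by (rule norm_blinfun_bound)
      (auto simp: scaleC_blinfun.rep_eq norm_scaleC mult.assoc intro!: mult_left_mono norm_blinfun)
  show "norm (a *\<^sub>C T) = cmod a * norm T"
  proof (cases "a = 0")
    case True
    then show ?thesis using le[of a T] by simp
  next
    case False
    have "inverse a *\<^sub>C a *\<^sub>C T = T"
      using False by transfer (simp add: scaleC_scaleC scaleC_one)
    then have "norm T \<le> norm (a *\<^sub>C T) / cmod a"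
      using le[of "inverse a" "a *\<^sub>C T"] by (simp add: norm_inverse divide_inverse mult.commute)
    then show ?thesis
      using le[of a T] False by (simp add: pos_le_divide_eq mult.commute)
  qed
qed

end

text \<open>The spectrum in the algebra of bounded complex-linear operators. The type \<open>\<Rightarrow>\<^sub>L\<close> consists of
  the bounded real-linear operators, so complex linearity of the inverse is required separately.\<close>

definition spectrum :: "('a :: complex_normed_vector \<Rightarrow>\<^sub>L 'a) \<Rightarrow> complex set"
  where "spectrum T = {z. \<not> (\<exists>R. clinear (blinfun_apply R) \<and>
           R o\<^sub>L (T - z *\<^sub>C id_blinfun) = id_blinfun \<and>
           (T - z *\<^sub>C id_blinfun) o\<^sub>L R = id_blinfun)}"


section \<open>Pointed metric spaces and Lipschitz functions vanishing at the base point\<close>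

class pointed_metric_space = metric_space +
  fixes basepoint :: 'a

typedef (overloaded) ('a :: pointed_metric_space) lip0 =
  "{g :: 'a \<Rightarrow> complex. g basepoint = 0 \<and> (\<exists>L. L-lipschitz_on UNIV g)}"
  morphisms lip0_apply Lip0
  by (rule exI[of _ "\<lambda>_. 0"]) (auto intro: lipschitz_on_constant)

setup_lifting type_definition_lip0

definition lipschitz_const :: "('a :: metric_space \<Rightarrow> 'b :: metric_space) \<Rightarrow> real"
  where "lipschitz_const g = Inf {L. L-lipschitz_on UNIV g}"

lemma lipschitz_const_lipschitz:
  assumes "L-lipschitz_on UNIV g"
  shows "(lipschitz_const g)-lipschitz_on UNIV g"
proof -
  have ne: "{L. L-lipschitz_on UNIV g} \<noteq> {}"
    using assms by auto
  show ?thesis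
  proof (rule lipschitz_onI)
    show "0 \<le> lipschitz_const g"
      unfolding lipschitz_const_def using ne
      by (rule cInf_greatest) (auto dest: lipschitz_on_nonneg)
    fix x y
    show "dist (g x) (g y) \<le> lipschitz_const g * dist x y"
    proof (cases "x = y")
      case False
      have "dist (g x) (g y) / dist x y \<le> lipschitz_const g"
        unfolding lipschitz_const_def using ne
        by (rule cInf_greatest)
          (use False in \<open>auto simp: pos_divide_le_eq dest: lipschitz_onD\<close>)
      then show ?thesis
        using False by (simp add: pos_divide_le_eq)
    qed simp
  qed
qed

lemma lipschitz_const_le: "L-lipschitz_on UNIV g \<Longrightarrow> lipschitz_const g \<le> L"
  unfolding lipschitz_const_def
  by (rule cInf_lower) (auto intro!: bdd_belowI[where m = 0] dest: lipschitz_on_nonneg)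

lemma lipschitz_const_scale:
  fixes g :: "'a :: metric_space \<Rightarrow> complex"
  assumes "L-lipschitz_on UNIV g"
  shows "(cmod c * lipschitz_const g)-lipschitz_on UNIV (\<lambda>x. c * g x)"
proof (rule lipschitz_onI)
  fix x y
  have "dist (c * g x) (c * g y) = cmod c * dist (g x) (g y)"
    by (simp add: dist_norm norm_mult flip: right_diff_distrib)
  also have "\<dots> \<le> cmod c * (lipschitz_const g * dist x y)"
    by (intro mult_left_mono lipschitz_onD[OF lipschitz_const_lipschitz[OF assms]]) auto
  finally show "dist (c * g x) (c * g y) \<le> cmod c * lipschitz_const g * dist x y"
    by (simp add: mult.assoc)
qed (use lipschitz_on_nonneg[OF lipschitz_const_lipschitz[OF assms]] in auto)

lemma lipschitz_const_scale_eq: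
  fixes g :: "'a :: metric_space \<Rightarrow> complex"
  assumes "L-lipschitz_on UNIV g"
  shows "lipschitz_const (\<lambda>x. c * g x) = cmod c * lipschitz_const g"
proof (rule antisym)
  note l = lipschitz_const_scale[OF assms, of c]
  show "lipschitz_const (\<lambda>x. c * g x) \<le> cmod c * lipschitz_const g"
    by (rule lipschitz_const_le[OF l])
  show "cmod c * lipschitz_const g \<le> lipschitz_const (\<lambda>x. c * g x)"
  proof (cases "c = 0")
    case True
    then show ?thesis
      using lipschitz_on_nonneg[OF lipschitz_const_lipschitz[OF l]] by simp
  next
    case False
    have "lipschitz_const g \<le> cmod (inverse c) * lipschitz_const (\<lambda>x. c * g x)"
      using lipschitz_const_le[OF lipschitz_const_scale[OF l, of "inverse c"]] False
      by (simp flip: mult.assoc)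
    also have "\<dots> = lipschitz_const (\<lambda>x. c * g x) / cmod c"
      by (simp add: norm_inverse divide_inverse mult.commute)
    finally show ?thesis
      using False by (simp add: pos_le_divide_eq mult.commute)
  qed
qed

instantiation lip0 :: (pointed_metric_space) complex_normed_vector
begin

lift_definition zero_lip0 :: "'a lip0" is "\<lambda>_. 0"
  by (auto intro: lipschitz_on_constant)

lift_definition plus_lip0 :: "'a lip0 \<Rightarrow> 'a lip0 \<Rightarrow> 'a lip0" is "\<lambda>g h x. g x + h x"
  by (auto intro: lipschitz_on_add)

lift_definition minus_lip0 :: "'a lip0 \<Rightarrow> 'a lip0 \<Rightarrow> 'a lip0" is "\<lambda>g h x. g x - h x"
  by (auto intro: lipschitz_on_diff)

lift_definition uminus_lip0 :: "'a lip0 \<Rightarrow> 'a lip0" is "\<lambda>g x. - g x"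
  by (auto intro: lipschitz_on_minus)

lift_definition scaleC_lip0 :: "complex \<Rightarrow> 'a lip0 \<Rightarrow> 'a lip0" is "\<lambda>c g x. c * g x"
  by (auto intro: lipschitz_const_scale)

definition scaleR_lip0 :: "real \<Rightarrow> 'a lip0 \<Rightarrow> 'a lip0"
  where "scaleR_lip0 r g = complex_of_real r *\<^sub>C g"

lift_definition norm_lip0 :: "'a lip0 \<Rightarrow> real" is lipschitz_const .

definition sgn_lip0 :: "'a lip0 \<Rightarrow> 'a lip0"
  where "sgn_lip0 g = scaleR (inverse (norm g)) g"

definition dist_lip0 :: "'a lip0 \<Rightarrow> 'a lip0 \<Rightarrow> real"
  where "dist_lip0 g h = norm (g - h)"

definition uniformity_lip0 :: "('a lip0 \<times> 'a lip0) filter"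
  where "uniformity_lip0 = (INF e\<in>{0 <..}. principal {(x, y). dist x y < e})"

definition open_lip0 :: "'a lip0 set \<Rightarrow> bool"
  where "open_lip0 S = (\<forall>x\<in>S. \<forall>\<^sub>F (x', y) in uniformity. x' = x \<longrightarrow> y \<in> S)"

instance
proof
  fix a b :: complex and r s :: real and g h k :: "'a lip0" and U :: "'a lip0 set"
  show "g + h + k = g + (h + k)" "g + h = h + g" "0 + g = g" "- g + g = 0" "g - h = g + - h"
    by (transfer; simp add: algebra_simps)+
  show "a *\<^sub>C (g + h) = a *\<^sub>C g + a *\<^sub>C h" "(a + b) *\<^sub>C g = a *\<^sub>C g + b *\<^sub>C g"
    "a *\<^sub>C b *\<^sub>C g = (a * b) *\<^sub>C g"
    by (transfer; simp add: algebra_simps)+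
  show "r *\<^sub>R (g + h) = r *\<^sub>R g + r *\<^sub>R h" "(r + s) *\<^sub>R g = r *\<^sub>R g + s *\<^sub>R g"
    "r *\<^sub>R s *\<^sub>R g = (r * s) *\<^sub>R g" "1 *\<^sub>R g = g"
    unfolding scaleR_lip0_def by (transfer; simp add: algebra_simps)+
  show "r *\<^sub>R g = complex_of_real r *\<^sub>C g"
    by (rule scaleR_lip0_def)
  show nC: "norm (a *\<^sub>C g) = cmod a * norm g" for a
    by transfer (auto intro: lipschitz_const_scale_eq)
  show "norm (r *\<^sub>R g) = \<bar>r\<bar> * norm g"
    by (simp add: scaleR_lip0_def nC)
  show "norm (g + h) \<le> norm g + norm h"
    by transfer (auto intro!: lipschitz_const_le lipschitz_on_add lipschitz_const_lipschitz)
  show "(norm g = 0) = (g = 0)"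
  proof
    show "norm g = 0 \<Longrightarrow> g = 0"
    proof transfer
      fix g :: "'a \<Rightarrow> complex"
      assume g: "g basepoint = 0 \<and> (\<exists>L. L-lipschitz_on UNIV g)" and "lipschitz_const g = 0"
      then have "0-lipschitz_on UNIV g"
        using lipschitz_const_lipschitz by metis
      then have "dist (g x) (g basepoint) \<le> 0 * dist x basepoint" for x
        by (rule lipschitz_onD) auto
      then show "g = (\<lambda>_. 0)"
        using g by (simp add: fun_eq_iff)
    qed
    have "norm (0 :: 'a lip0) \<le> 0"
      by transfer (rule lipschitz_const_le, rule lipschitz_on_constant)
    moreover have "0 \<le> norm (0 :: 'a lip0)"
      by transfer (rule lipschitz_on_nonneg, rule lipschitz_const_lipschitz, rule lipschitz_on_constant)
    ultimately show "g = 0 \<Longrightarrow> norm g = 0"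
      by simp
  qed
  show "sgn g = inverse (norm g) *\<^sub>R g" "dist g h = norm (g - h)"
    by (fact sgn_lip0_def dist_lip0_def)+
  show "uniformity = (INF e\<in>{0 <..}. principal {(x :: 'a lip0, y). dist x y < e})"
    by (fact uniformity_lip0_def)
  show "open U = (\<forall>x\<in>U. \<forall>\<^sub>F (x', y) in uniformity. x' = x \<longrightarrow> y \<in> U)"
    by (fact open_lip0_def)
qed

end

lemma lip0_basepoint [simp]: "lip0_apply g basepoint = 0"
  using lip0_apply[of g] by auto

lemma lip0_lipschitz: "(norm g)-lipschitz_on UNIV (lip0_apply g)"
  using lip0_apply[of g] by (auto simp: norm_lip0.rep_eq intro: lipschitz_const_lipschitz)


section \<open>The complex Lipschitz-free space\<close>

lift_definition dirac :: "'a :: pointed_metric_space \<Rightarrow> 'a lip0 \<Rightarrow>\<^sub>L complex"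
  is "\<lambda>x g. lip0_apply g x"
proof (rule bounded_linear_intro)
  fix x :: 'a and g h :: "'a lip0" and r :: real
  show "lip0_apply (g + h) x = lip0_apply g x + lip0_apply h x"
    by (simp add: plus_lip0.rep_eq)
  show "lip0_apply (r *\<^sub>R g) x = r *\<^sub>R lip0_apply g x"
    by (simp add: scaleR_lip0_def scaleC_lip0.rep_eq scaleR_conv_of_real)
  show "norm (lip0_apply g x) \<le> norm g * dist x basepoint"
    using lipschitz_onD[OF lip0_lipschitz, of x basepoint g] by (simp add: dist_norm)
qed

lemma csubspace_closure:
  assumes "csubspace (S :: 'a :: complex_normed_vector set)"
  shows "csubspace (closure S)"
proof (rule complex_vector.subspaceI)
  show "0 \<in> closure S"
    using complex_vector.subspace_0[OF assms] closure_subset by blast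
  fix x y assume "x \<in> closure S" "y \<in> closure S"
  then show "x + y \<in> closure S"
    unfolding closure_sequential
    by (metis (no_types, lifting) tendsto_add complex_vector.subspace_add[OF assms])
next
  fix c :: complex and x assume "x \<in> closure S"
  then show "c *\<^sub>C x \<in> closure S"
    unfolding closure_sequential
    by (metis (no_types, lifting) bounded_linear.tendsto[OF bounded_linear_scaleC]
        complex_vector.subspace_scale[OF assms])
qed

text \<open>The bounded complex-linear functionals form a closed complex subspace of
  \<open>'a lip0 \<Rightarrow>\<^sub>L complex\<close> (the bounded real-linear ones), with the same norm; it contains all
  \<open>dirac x\<close>, so the closed span may be formed in the larger space
  (see \<open>lipschitz_free_clinear\<close> below).\<close>

typedef (overloaded) ('a :: pointed_metric_space) lipschitz_free =
  "closure (cspan (range (dirac :: 'a \<Rightarrow> 'a lip0 \<Rightarrow>\<^sub>L complex)))"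
  morphisms free_functional Lipschitz_Free
  using csubspace_closure[OF complex_vector.subspace_span] complex_vector.subspace_0 by blast

setup_lifting type_definition_lipschitz_free

lemma csubspace_free:
  "csubspace (closure (cspan (range (dirac :: 'a :: pointed_metric_space \<Rightarrow> _))))"
  by (rule csubspace_closure) (rule complex_vector.subspace_span)

instantiation lipschitz_free :: (pointed_metric_space) complex_normed_vector
begin

lift_definition zero_lipschitz_free :: "'a lipschitz_free" is 0
  by (rule complex_vector.subspace_0[OF csubspace_free])

lift_definition plus_lipschitz_free ::
  "'a lipschitz_free \<Rightarrow> 'a lipschitz_free \<Rightarrow> 'a lipschitz_free" is "(+)"
  by (rule complex_vector.subspace_add[OF csubspace_free])

lift_definition minus_lipschitz_free ::
  "'a lipschitz_free \<Rightarrow> 'a lipschitz_free \<Rightarrow> 'a lipschitz_free" is "(-)"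
  by (rule complex_vector.subspace_diff[OF csubspace_free])

lift_definition uminus_lipschitz_free :: "'a lipschitz_free \<Rightarrow> 'a lipschitz_free" is uminus
  by (rule complex_vector.subspace_neg[OF csubspace_free])

lift_definition scaleC_lipschitz_free ::
  "complex \<Rightarrow> 'a lipschitz_free \<Rightarrow> 'a lipschitz_free" is scaleC
  by (rule complex_vector.subspace_scale[OF csubspace_free])

lift_definition scaleR_lipschitz_free ::
  "real \<Rightarrow> 'a lipschitz_free \<Rightarrow> 'a lipschitz_free" is scaleR
  by (simp add: scaleR_scaleC complex_vector.subspace_scale[OF csubspace_free])

lift_definition norm_lipschitz_free :: "'a lipschitz_free \<Rightarrow> real" is norm .

definition sgn_lipschitz_free :: "'a lipschitz_free \<Rightarrow> 'a lipschitz_free"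
  where "sgn_lipschitz_free m = scaleR (inverse (norm m)) m"

definition dist_lipschitz_free :: "'a lipschitz_free \<Rightarrow> 'a lipschitz_free \<Rightarrow> real"
  where "dist_lipschitz_free m n = norm (m - n)"

definition uniformity_lipschitz_free :: "('a lipschitz_free \<times> 'a lipschitz_free) filter"
  where "uniformity_lipschitz_free = (INF e\<in>{0 <..}. principal {(x, y). dist x y < e})"

definition open_lipschitz_free :: "'a lipschitz_free set \<Rightarrow> bool"
  where "open_lipschitz_free S = (\<forall>x\<in>S. \<forall>\<^sub>F (x', y) in uniformity. x' = x \<longrightarrow> y \<in> S)"

instance
proof
  fix a b :: complex and r s :: real and g h k :: "'a lipschitz_free" and U :: "'a lipschitz_free set"
  show "g + h + k = g + (h + k)" "g + h = h + g" "0 + g = g" "- g + g = 0" "g - h = g + - h"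
    by (transfer; simp add: algebra_simps)+
  show "a *\<^sub>C (g + h) = a *\<^sub>C g + a *\<^sub>C h" "(a + b) *\<^sub>C g = a *\<^sub>C g + b *\<^sub>C g"
    "a *\<^sub>C b *\<^sub>C g = (a * b) *\<^sub>C g" "r *\<^sub>R g = complex_of_real r *\<^sub>C g"
    "norm (a *\<^sub>C g) = cmod a * norm g"
    by (transfer; simp add: scaleC_add_right scaleC_add_left scaleC_scaleC scaleR_scaleC norm_scaleC)+
  show "r *\<^sub>R (g + h) = r *\<^sub>R g + r *\<^sub>R h" "(r + s) *\<^sub>R g = r *\<^sub>R g + s *\<^sub>R g"
    "r *\<^sub>R s *\<^sub>R g = (r * s) *\<^sub>R g" "1 *\<^sub>R g = g" "norm (r *\<^sub>R g) = \<bar>r\<bar> * norm g"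
    "(norm g = 0) = (g = 0)"
    by (transfer; simp add: algebra_simps)+
  show "norm (g + h) \<le> norm g + norm h"
    by transfer (rule norm_triangle_ineq)
  show "sgn g = inverse (norm g) *\<^sub>R g" "dist g h = norm (g - h)"
    by (fact sgn_lipschitz_free_def dist_lipschitz_free_def)+
  show "uniformity = (INF e\<in>{0 <..}. principal {(x :: 'a lipschitz_free, y). dist x y < e})"
    by (fact uniformity_lipschitz_free_def)
  show "open U = (\<forall>x\<in>U. \<forall>\<^sub>F (x', y) in uniformity. x' = x \<longrightarrow> y \<in> U)"
    by (fact open_lipschitz_free_def)
qed

end

lemma dist_free_functional: "dist (free_functional m) (free_functional n) = dist m n"
  by (simp add: dist_norm norm_lipschitz_free.rep_eq minus_lipschitz_free.rep_eq)

instance lipschitz_free :: (pointed_metric_space) banach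
proof
  fix X :: "nat \<Rightarrow> 'a lipschitz_free"
  assume "Cauchy X"
  then have "Cauchy (\<lambda>n. free_functional (X n))"
    by (simp add: Cauchy_def dist_free_functional)
  then obtain l where l: "(\<lambda>n. free_functional (X n)) \<longlonglongrightarrow> l"
    by (auto simp: Cauchy_convergent_iff convergent_def)
  have "l \<in> closure (cspan (range dirac))"
    using closed_closure free_functional l by (rule closed_sequentially)
  then obtain m where "l = free_functional m"
    by (metis Lipschitz_Free_inverse)
  with l have "X \<longlonglongrightarrow> m"
    by (simp add: tendsto_iff dist_free_functional)
  then show "convergent X"
    by (auto simp: convergent_def)
qed

lift_definition free_dirac :: "'a :: pointed_metric_space \<Rightarrow> 'a lipschitz_free" is dirac
  by (meson closure_subset complex_vector.span_base rangeI subsetD)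

lemma clinear_dirac: "clinear (blinfun_apply (dirac x))"
  by (rule clinearI) (simp_all add: dirac.rep_eq plus_lip0.rep_eq scaleC_lip0.rep_eq scaleC_complex_def)

lemma lipschitz_free_clinear: "clinear (blinfun_apply (free_functional m))"
proof (rule clinearI)
  let ?A = "\<lambda>c g. {p :: 'a lip0 \<Rightarrow>\<^sub>L complex. p (c *\<^sub>C g) = c *\<^sub>C p g}"
  fix c and g :: "'a lip0"
  have "closed (?A c g)"
    by (intro closed_Collect_eq bounded_linear.continuous_on[OF bounded_linear_scaleC]
        linear_continuous_on bounded_linear_apply_blinfun)
  moreover have "cspan (range dirac) \<subseteq> ?A c g"
  proof (rule complex_vector.span_minimal)
    show "range dirac \<subseteq> ?A c g"
      using clinearD(2)[OF clinear_dirac] by auto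
    show "csubspace (?A c g)"
      by (rule complex_vector.subspaceI)
        (auto simp: scaleC_blinfun.rep_eq blinfun.add_left scaleC_complex_def algebra_simps)
  qed
  ultimately have "closure (cspan (range dirac)) \<subseteq> ?A c g"
    by (rule closure_minimal[rotated])
  then show "free_functional m (c *\<^sub>C g) = c *\<^sub>C free_functional m g"
    using free_functional[of m] by auto
qed (simp add: blinfun.add_right)


section \<open>The operator induced by a Lipschitz map\<close>

definition lipschitz_op ::
    "('a :: pointed_metric_space \<Rightarrow> 'a) \<Rightarrow> 'a lipschitz_free \<Rightarrow>\<^sub>L 'a lipschitz_free"
  where "lipschitz_op f = (THE T. clinear (blinfun_apply T) \<and>
           (\<forall>x. T (free_dirac x) = free_dirac (f x)))"

text \<open>The operator exists and is unique: it is the restriction of the adjoint of \<open>g \<mapsto> g \<circ> f\<close>.\<close>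

lemma ex1_lipschitz_op:
  fixes f :: "'a :: pointed_metric_space \<Rightarrow> 'a"
  assumes f: "L-lipschitz_on UNIV f" and f0: "f basepoint = basepoint"
  shows "\<exists>!T :: 'a lipschitz_free \<Rightarrow>\<^sub>L 'a lipschitz_free.
           clinear (blinfun_apply T) \<and> (\<forall>x. T (free_dirac x) = free_dirac (f x))"
proof (rule ex_ex1I)
  define C where "C g = Lip0 (lip0_apply g \<circ> f)" for g :: "'a lip0"
  have lip: "(norm g * L)-lipschitz_on UNIV (lip0_apply g \<circ> f)" for g :: "'a lip0"
    using f by (rule lipschitz_on_compose) (rule lipschitz_on_subset[OF lip0_lipschitz], simp)
  have C: "lip0_apply (C g) = lip0_apply g \<circ> f" for g
    unfolding C_def using lip[of g] by (intro Lip0_inverse) (auto simp: f0)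
  have blC: "bounded_linear C"
  proof (rule bounded_linear_intro[where K = L])
    fix g h :: "'a lip0" and r :: real
    show "C (g + h) = C g + C h"
      by (simp add: C plus_lip0.rep_eq fun_eq_iff flip: lip0_apply_inject)
    show "C (r *\<^sub>R g) = r *\<^sub>R C g"
      by (simp add: C scaleR_lip0_def scaleC_lip0.rep_eq fun_eq_iff flip: lip0_apply_inject)
    show "norm (C g) \<le> norm g * L"
      unfolding norm_lip0.rep_eq C using lipschitz_const_le[OF lip[of g]]
      by (simp add: norm_lip0.rep_eq)
  qed
  define A where "A p = p o\<^sub>L Blinfun C" for p :: "'a lip0 \<Rightarrow>\<^sub>L complex"
  have A_apply: "A p g = p (C g)" for p g
    by (simp add: A_def bounded_linear_Blinfun_apply[OF blC])
  have blA: "bounded_linear A"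
    unfolding A_def by (rule bounded_bilinear.bounded_linear_left) (rule bounded_bilinear_blinfun_compose)
  have A_dirac: "A (dirac x) = dirac (f x)" for x
    by (rule blinfun_eqI) (simp add: A_apply dirac.rep_eq C)
  have A_scaleC: "A (c *\<^sub>C p) = c *\<^sub>C A p" for c p
    by (rule blinfun_eqI) (simp add: A_apply scaleC_blinfun.rep_eq)
  have A_add: "A (p + q) = A p + A q" for p q
    by (rule blinfun_eqI) (simp add: A_apply blinfun.add_left)
  let ?F = "closure (cspan (range (dirac :: 'a \<Rightarrow> _)))"
  have "cspan (range dirac) \<subseteq> A -` ?F"
  proof (rule complex_vector.span_minimal)
    show "range dirac \<subseteq> A -` ?F"
      using subsetD[OF closure_subset complex_vector.span_base[OF rangeI]] by (auto simp: A_dirac)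
    show "csubspace (A -` ?F)"
      by (rule complex_vector.subspaceI)
        (auto simp: A_add A_scaleC linear_simps(3)[OF blA] complex_vector.subspace_0[OF csubspace_free]
          complex_vector.subspace_add[OF csubspace_free]
          complex_vector.subspace_scale[OF csubspace_free])
  qed
  moreover have "closed (A -` ?F)"
    by (rule continuous_closed_vimage) (auto intro: linear_continuous_at[OF blA])
  ultimately have AF: "?F \<subseteq> A -` ?F"
    by (rule closure_minimal)
  define T where "T m = Lipschitz_Free (A (free_functional m))" for m
  have T: "free_functional (T m) = A (free_functional m)" for m
    unfolding T_def using AF free_functional[of m] by (intro Lipschitz_Free_inverse) auto
  obtain K where K: "\<And>p. norm (A p) \<le> norm p * K"
    using bounded_linear.bounded[OF blA] by auto
  have blT: "bounded_linear T"
  proof (rule bounded_linear_intro)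
    fix m n :: "'a lipschitz_free" and r :: real
    show "T (m + n) = T m + T n"
      by (simp add: T plus_lipschitz_free.rep_eq A_add flip: free_functional_inject)
    show "T (r *\<^sub>R m) = r *\<^sub>R T m"
      by (simp add: T scaleR_lipschitz_free.rep_eq linear_simps(5)[OF blA] flip: free_functional_inject)
    show "norm (T m) \<le> norm m * K"
      using K[of "free_functional m"] by (simp add: T norm_lipschitz_free.rep_eq)
  qed
  have "clinear T"
  proof (rule clinearI)
    show "T (m + n) = T m + T n" for m n
      using blT by (simp add: linear_simps)
    show "T (c *\<^sub>C m) = c *\<^sub>C T m" for c m
      by (simp add: T scaleC_lipschitz_free.rep_eq A_scaleC flip: free_functional_inject)
  qed
  moreover have "T (free_dirac x) = free_dirac (f x)" for x
    by (simp add: T free_dirac.rep_eq A_dirac flip: free_functional_inject)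
  ultimately show "\<exists>T :: 'a lipschitz_free \<Rightarrow>\<^sub>L 'a lipschitz_free.
      clinear (blinfun_apply T) \<and> (\<forall>x. T (free_dirac x) = free_dirac (f x))"
    by (intro exI[of _ "Blinfun T"]) (simp add: bounded_linear_Blinfun_apply[OF blT])
next
  fix S T :: "'a lipschitz_free \<Rightarrow>\<^sub>L 'a lipschitz_free"
  assume S: "clinear (blinfun_apply S) \<and> (\<forall>x. S (free_dirac x) = free_dirac (f x))"
    and T: "clinear (blinfun_apply T) \<and> (\<forall>x. T (free_dirac x) = free_dirac (f x))"
  let ?P = "\<lambda>p. S (Lipschitz_Free p) = T (Lipschitz_Free p)"
  have span: "p \<in> closure (cspan (range dirac)) \<and> ?P p" if "p \<in> cspan (range dirac)" for p
    using that
  proof (induction rule: complex_vector.span_induct_alt)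
    case base
    have "Lipschitz_Free 0 = (0 :: 'a lipschitz_free)"
      by (simp add: zero_lipschitz_free_def)
    then show ?case
      by (simp add: complex_vector.subspace_0[OF csubspace_free])
  next
    case (step c d p)
    from step(1) obtain x where d: "d = dirac x" by auto
    let ?m = "c *\<^sub>C free_dirac x + Lipschitz_Free p"
    have m: "free_functional ?m = c *\<^sub>C d + p"
      using step(2) by (simp add: d plus_lipschitz_free.rep_eq scaleC_lipschitz_free.rep_eq
          free_dirac.rep_eq Lipschitz_Free_inverse)
    have "S ?m = T ?m"
      using S T step(2) clinearD[of "blinfun_apply S"] clinearD[of "blinfun_apply T"] by simp
    then show ?case
      using free_functional[of ?m] free_functional_inverse[of ?m] by (simp add: m)
  qed
  show "S = T"
  proof (rule blinfun_eqI)
    fix m :: "'a lipschitz_free"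
    obtain q where q: "\<And>n. q n \<in> cspan (range dirac)" and lim: "q \<longlonglongrightarrow> free_functional m"
      using free_functional[of m] unfolding closure_sequential by auto
    define X where "X n = Lipschitz_Free (q n)" for n
    have X: "free_functional (X n) = q n" for n
      unfolding X_def using span[OF q] by (simp add: Lipschitz_Free_inverse)
    have "X \<longlonglongrightarrow> m"
      using lim by (simp add: tendsto_iff X flip: dist_free_functional)
    then have "(\<lambda>n. S (X n)) \<longlonglongrightarrow> S m" "(\<lambda>n. T (X n)) \<longlonglongrightarrow> T m"
      by (auto intro: tendsto_intros)
    moreover have "S (X n) = T (X n)" for n
      unfolding X_def using span[OF q] by simp
    ultimately show "S m = T m"
      using LIMSEQ_unique by simp
  qed
qed

lemma lipschitz_op:
  assumes "L-lipschitz_on UNIV f" "f basepoint = basepoint"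
  shows "clinear (blinfun_apply (lipschitz_op f))" "lipschitz_op f (free_dirac x) = free_dirac (f x)"
  using theI'[OF ex1_lipschitz_op[OF assms]] unfolding lipschitz_op_def by auto


section \<open>Topological transitivity\<close>

definition topologically_transitive :: "('a :: topological_space \<Rightarrow> 'a) \<Rightarrow> bool"
  where "topologically_transitive f \<longleftrightarrow> continuous_on UNIV f \<and>
           (\<forall>U V. open U \<and> open V \<and> U \<noteq> {} \<and> V \<noteq> {} \<longrightarrow>
              (\<exists>n\<ge>1. (f ^^ n) ` U \<inter> V \<noteq> {}))"

end

theory Submission
  imports Defs "HOL-Complex_Analysis.Riemann_Mapping"
begin

text \<open>
  Let \<open>S\<close> be the operator induced by \<open>f\<close> and suppose that a component of its spectrum misses the unit
  circle. Then the spectrum has a nonempty compact, relatively open part \<open>K\<close> inside the open unit disc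
  or outside the closed one. In the first case consider the pencil \<open>S - z I\<close>, in the second \<open>I - z S\<close>
  (the substitution \<open>z \<mapsto> 1/z\<close>); either way it is a pencil \<open>B - z E\<close> that fails to be invertible on a
  compact piece of the open disc, isolated from the remaining singular set. Some loop in the disc
  avoids the singular set and winds around a point of that piece. The operators
  \<open>T\<^sub>n = \<integral> z\<^sup>n (B - z E)\<^sup>-\<^sup>1 dz\<close> along it tend to \<open>0\<close> and satisfy \<open>B T\<^sub>n = E T\<^sub>n\<^sub>+\<^sub>1\<close>, while \<open>E T\<^sub>0 \<noteq> 0\<close>.
  So \<open>T\<^sub>0 S\<^sup>n = T\<^sub>n\<close> in the first case and \<open>T\<^sub>0 = T\<^sub>n S\<^sup>n\<close> in the second. By transitivity there are points
  near any given \<open>y\<close> that are reached from (respectively mapped to) a fixed ball by arbitrarily high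
  iterates of \<open>f\<close>, hence \<open>T\<^sub>0\<close> vanishes at \<open>\<delta>\<^sub>y\<close>, and therefore everywhere, a contradiction.
  Only continuity of the resolvent is used, not its holomorphy.
\<close>

section \<open>Loops around compact subsets of open plane sets\<close>

text \<open>Along a loop a continuous logarithm of \<open>z - a\<close> changes by
  \<open>2 * pi * \<i>\<close> times the winding number. If this is zero, loops lift to loops
  through the covering \<open>exp\<close> of the punctured plane, and the lifting criterion yields a
  global logarithm.\<close>

lemma continuous_log_if_winding_numbers_zero_connected:
  fixes U :: "complex set"
  assumes "open U" "connected U" and a: "a \<notin> U"
    and wn: "\<And>r. \<lbrakk>path r; path_image r \<subseteq> U; pathfinish r = pathstart r\<rbrakk> \<Longrightarrow> winding_number r a = 0"
  obtains g where "continuous_on U g" "\<And>z. z \<in> U \<Longrightarrow> exp (g z) = z - a"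
proof (cases "U = {}")
  case True
  then show ?thesis using that by auto
next
  case False
  then obtain z0 where z0: "z0 \<in> U" by auto
  with a have "z0 - a \<noteq> 0" by auto
  then have e0: "z0 - a = exp (Ln (z0 - a))" by simp
  have "\<exists>q. path q \<and> path_image q \<subseteq> UNIV \<and> pathstart q = Ln (z0 - a) \<and> pathfinish q = Ln (z0 - a)
      \<and> homotopic_paths (- {0}) ((\<lambda>z. z - a) \<circ> r) (exp \<circ> q)"
    if r: "path r" "path_image r \<subseteq> U" "pathstart r = z0" "pathfinish r = z0" for r
  proof -
    have ar: "a \<notin> path_image r" using r(2) a by auto
    obtain q where q: "path q" "pathfinish q - pathstart q = 2 * of_real pi * \<i> * winding_number r a"
      "\<And>t. t \<in> {0..1} \<Longrightarrow> r t = a + exp (q t)"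
      using winding_number_as_continuous_log[OF r(1) ar] by blast
    have loop: "pathfinish q = pathstart q" using q(2) wn r by simp
    \<comment> \<open>The lift \<open>q\<close> may start at any logarithm of \<open>z0 - a\<close>.
      Shifting it by the period \<open>c\<close> of \<open>exp\<close> makes it start at the
      principal one, as the lifting criterion demands.\<close>
    define c where "c = Ln (z0 - a) - pathstart q"
    have "exp (pathstart q) = z0 - a"
      using q(3)[of 0] r(3) by (simp add: pathstart_def algebra_simps)
    then have c: "exp c = 1" using \<open>z0 - a \<noteq> 0\<close> by (simp add: c_def exp_diff)
    have pq: "path (\<lambda>t. q t + c)" using q(1) unfolding path_def by (intro continuous_intros)
    have eq: "((\<lambda>z. z - a) \<circ> r) t = (exp \<circ> (\<lambda>t. q t + c)) t" if "t \<in> {0..1}" for t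
      using q(3)[OF that] c by (simp add: exp_add)
    have "path ((\<lambda>z. z - a) \<circ> r)"
      by (rule path_continuous_image[OF r(1)]) (intro continuous_intros)
    moreover have "path_image ((\<lambda>z. z - a) \<circ> r) \<subseteq> - {0}"
      using ar by (auto simp: path_image_def)
    ultimately have "homotopic_paths (- {0}) ((\<lambda>z. z - a) \<circ> r) (exp \<circ> (\<lambda>t. q t + c))"
      using eq by (intro homotopic_paths_eq) auto
    then show ?thesis
      using pq loop by (intro exI[of _ "\<lambda>t. q t + c"]) (auto simp: pathstart_def pathfinish_def c_def)
  qed
  note hom = this
  have cont: "continuous_on U (\<lambda>z. z - a)" by (intro continuous_intros)
  have im: "(\<lambda>z. z - a) \<in> U \<rightarrow> - {0}" using a by auto
  have pc: "path_connected U" "locally path_connected U"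
    using assms by (simp_all add: open_imp_locally_path_connected connected_open_path_connected)
  have "\<exists>g. continuous_on U g \<and> (\<forall>y\<in>U. exp (g y) = y - a)"
    by (rule covering_space_lift_general[OF covering_space_exp_punctured_plane UNIV_I z0 pc cont im e0 hom])
      blast+
  then show ?thesis using that by blast
qed

text \<open>Components of an open set are open, so logarithms chosen independently on them glue to a
  continuous one.\<close>

lemma continuous_log_if_winding_numbers_zero:
  fixes S :: "complex set"
  assumes "open S" and a: "a \<notin> S"
    and wn: "\<And>r. \<lbrakk>path r; path_image r \<subseteq> S; pathfinish r = pathstart r\<rbrakk> \<Longrightarrow> winding_number r a = 0"
  obtains g where "continuous_on S g" "\<And>z. z \<in> S \<Longrightarrow> exp (g z) = z - a"
proof -
  have "\<exists>g. continuous_on U g \<and> (\<forall>z\<in>U. exp (g z) = z - a)" if U: "U \<in> components S" for U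
  proof -
    have US: "U \<subseteq> S" using in_components_subset[OF U] .
    have "a \<notin> U" using US a by blast
    moreover have "winding_number r a = 0" if "path r" "path_image r \<subseteq> U" "pathfinish r = pathstart r" for r
      using that US by (intro wn) auto
    ultimately obtain g where "continuous_on U g" "\<And>z. z \<in> U \<Longrightarrow> exp (g z) = z - a"
      using continuous_log_if_winding_numbers_zero_connected[OF open_components[OF assms(1) U]
          in_components_connected[OF U]] by metis
    then show ?thesis by blast
  qed
  then have "\<forall>U\<in>components S. \<exists>g. continuous_on U g \<and> (\<forall>z\<in>U. exp (g z) = z - a)" by blast
  from bchoice[OF this] obtain G where
    G': "\<forall>U\<in>components S. continuous_on U (G U) \<and> (\<forall>z\<in>U. exp (G U z) = z - a)" ..
  have G: "continuous_on U (G U)" "\<And>z. z \<in> U \<Longrightarrow> exp (G U z) = z - a" if "U \<in> components S" for U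
    using G' that by auto
  define g where "g z = G (connected_component_set S z) z" for z
  have gU: "g z = G U z" if "U \<in> components S" "z \<in> U" for U z
  proof -
    obtain x where "U = connected_component_set S x" using \<open>U \<in> components S\<close> by (rule componentsE)
    then have "connected_component_set S z = U" using \<open>z \<in> U\<close> connected_component_eq by blast
    then show ?thesis by (simp add: g_def)
  qed
  have "continuous_on (\<Union>U\<in>components S. U) g"
  proof (rule continuous_on_open_UN)
    show "open U" if "U \<in> components S" for U using open_components assms(1) that by blast
    show "continuous_on U g" if "U \<in> components S" for U
      by (rule continuous_on_eq[OF G(1)[OF that]]) (simp add: gU[OF that])
  qed
  then have "continuous_on S g" by simp
  moreover have "exp (g z) = z - a" if "z \<in> S" for z
  proof -
    have "connected_component_set S z \<in> components S" "z \<in> connected_component_set S z"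
      using that by (auto simp: components_def)
    then show ?thesis by (simp add: G(2) gU)
  qed
  ultimately show ?thesis by (rule that)
qed

text \<open>Scaling \<open>F\<close> to constant modulus would retract a large closed disc onto its
  boundary circle, contrary to the no-retraction theorem.\<close>

lemma no_nonvanishing_extension:
  fixes F :: "complex \<Rightarrow> complex"
  assumes "continuous_on UNIV F" "\<And>z. F z \<noteq> 0" "bounded {z. F z \<noteq> z - a}"
  shows False
proof -
  obtain r where r: "r > 0" "{z. F z \<noteq> z - a} \<subseteq> ball a r"
    using bounded_subset_ballD[OF assms(3)] by blast
  define h where "h z = a + of_real r * (F z / of_real (cmod (F z)))" for z
  have "retraction (cball a r) (frontier (cball a r)) h"
    unfolding retraction_def
  proof (intro conjI ballI)
    show "continuous_on (cball a r) h"
      unfolding h_def using assms(2)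
      by (intro continuous_intros continuous_on_subset[OF assms(1)]) auto
    show "h \<in> cball a r \<rightarrow> frontier (cball a r)"
      using r(1) assms(2) by (auto simp: h_def dist_norm norm_mult norm_divide)
    \<comment> \<open>Points of the circle lie outside the open ball, so there \<open>F z\<close> is
      \<open>z - a\<close> and \<open>h\<close> fixes them.\<close>
    fix z assume "z \<in> frontier (cball a r)"
    then have z: "cmod (z - a) = r" by (simp add: dist_norm norm_minus_commute)
    then have "z \<notin> ball a r" by (simp add: dist_norm norm_minus_commute)
    then have "F z = z - a" using r(2) by auto
    then show "h z = z" using r(1) z by (simp add: h_def)
  qed auto
  then show False using no_retraction_cball[OF r(1), of a] by (auto simp: retract_of_def)
qed

text \<open>If all the winding numbers vanished, cutting off the logarithm of \<open>z - a\<close> near \<open>K\<close> would give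
  a nonvanishing continuous function on the plane that agrees with \<open>z - a\<close> outside a bounded set.\<close>

lemma loop_around_compact_in_open:
  fixes K V :: "complex set"
  assumes K: "compact K" "K \<subseteq> V" "a \<in> K" and V: "open V"
  obtains r where "path r" "path_image r \<subseteq> V - K" "pathfinish r = pathstart r" "winding_number r a \<noteq> 0"
proof (rule ccontr)
  assume nt: "\<not> thesis"
  obtain e where e: "e > 0" "(\<Union>x\<in>K. cball x e) \<subseteq> V"
    using compact_subset_open_imp_cball_epsilon_subset[OF K(1) V K(2)] by blast
  have opn: "open (V - K)" using K(1) V by (simp add: open_Diff compact_imp_closed)
  have wn: "winding_number r a = 0"
    if "path r" "path_image r \<subseteq> V - K" "pathfinish r = pathstart r" for r
    using nt \<open>\<And>r. \<lbrakk>path r; path_image r \<subseteq> V - K; pathfinish r = pathstart r; winding_number r a \<noteq> 0\<rbrakk>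
      \<Longrightarrow> thesis\<close> that by blast
  have "a \<notin> V - K" using K(3) by simp
  from continuous_log_if_winding_numbers_zero[OF opn this wn]
  obtain g where g: "continuous_on (V - K) g" "\<And>z. z \<in> V - K \<Longrightarrow> exp (g z) = z - a"
    by blast
  define d where "d z = infdist z K" for z
  have dc: "continuous_on S d" for S unfolding d_def by (intro continuous_intros)
  have Kne: "K \<noteq> {}" using K(3) by auto
  have dK: "z \<in> V" if "d z \<le> e" for z
  proof -
    obtain x where "x \<in> K" "d z = dist z x"
      using infdist_attains_inf[OF compact_imp_closed[OF K(1)] Kne] unfolding d_def by blast
    with that have "z \<in> (\<Union>x\<in>K. cball x e)" by (metis UN_I dist_commute mem_cball)
    with e(2) show ?thesis by (rule subsetD)
  qed
  have dpos: "z \<notin> K" if "d z > 0" for z using that by (auto simp: d_def)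
  \<comment> \<open>\<open>cut\<close> is 0 where \<open>d z \<le> e/2\<close> and 1 where
    \<open>d z \<ge> e\<close>. Multiplying the logarithm by it deforms \<open>z - a\<close> into
    the constant 1 on the way to \<open>K\<close>.\<close>
  define cut where "cut z = min 1 (max 0 (2 * d z / e - 1))" for z
  have cutc: "continuous_on S cut" for S unfolding cut_def
    using e(1) by (intro continuous_intros dc) auto
  define F where "F z = (if d z \<ge> e then z - a else if d z > 0 then exp (of_real (cut z) * g z) else 1)" for z
  \<comment> \<open>The open sets \<open>A1\<close>, \<open>V - K\<close> and \<open>A3\<close>
    cover the plane, and on each of them a single formula describes \<open>F\<close>.\<close>
  define A1 where "A1 = {z. d z < e/2}"
  define A3 where "A3 = {z. d z > e}"
  have oA: "open A1" "open A3" unfolding A1_def A3_def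
    by (auto intro!: open_Collect_less dc continuous_intros)
  have F1: "F z = 1" if "z \<in> A1" for z
  proof -
    have "2 * d z / e - 1 \<le> 0" using that e(1) by (simp add: A1_def field_simps)
    then have "cut z = 0" by (simp add: cut_def)
    then show ?thesis using that e(1) by (simp add: F_def A1_def)
  qed
  have F2: "F z = exp (of_real (cut z) * g z)" if "z \<in> V - K" for z
  proof -
    have "d z > 0" using that Kne K(1)
      by (metis DiffD2 d_def compact_imp_closed in_closed_iff_infdist_zero infdist_nonneg order_le_less)
    moreover have "cut z = 1" if "d z \<ge> e"
    proof -
      have "2 * d z / e - 1 \<ge> 1" using that e(1) by (simp add: field_simps)
      then show ?thesis by (simp add: cut_def)
    qed
    ultimately show ?thesis using g(2)[OF that] by (auto simp: F_def)
  qed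
  have F3: "F z = z - a" if "z \<in> A3" for z using that by (simp add: F_def A3_def)
  have "continuous_on (A1 \<union> (V - K) \<union> A3) F"
  proof (intro continuous_on_open_Un oA opn open_Un)
    show "continuous_on A1 F"
      by (rule continuous_on_eq[of _ "\<lambda>_. 1"]) (auto simp: F1)
    show "continuous_on (V - K) F"
      by (rule continuous_on_eq[of _ "\<lambda>z. exp (of_real (cut z) * g z)"])
        (auto simp: F2 intro!: continuous_intros g cutc)
    show "continuous_on A3 F"
      by (rule continuous_on_eq[of _ "\<lambda>z. z - a"]) (auto simp: F3 intro!: continuous_intros)
  qed
  moreover have cover: "A1 \<union> (V - K) \<union> A3 = UNIV"
    using dK dpos e(1) by (force simp: A1_def A3_def not_less)
  ultimately have "continuous_on UNIV F" by simp
  moreover have "F z \<noteq> 0" for z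
  proof -
    \<comment> \<open>The only zero of \<open>z - a\<close> lies in \<open>K\<close>, where
      \<open>F\<close> has the value 1.\<close>
    have "d a = 0" using K(3) by (simp add: d_def)
    then show ?thesis using e(1) by (auto simp: F_def)
  qed
  moreover have "bounded {z. F z \<noteq> z - a}"
  proof -
    obtain D where D: "\<And>x. x \<in> K \<Longrightarrow> cmod x \<le> D"
      using compact_imp_bounded[OF K(1)] by (auto simp: bounded_iff)
    show ?thesis
    proof (rule boundedI)
      fix z assume "z \<in> {z. F z \<noteq> z - a}"
      then have "d z < e" by (auto simp: F_def split: if_splits)
      moreover obtain x where "x \<in> K" "d z = dist z x"
        using infdist_attains_inf[OF compact_imp_closed[OF K(1)] Kne] unfolding d_def by blast
      ultimately show "cmod z \<le> D + e"
        using D[of x] norm_triangle_sub[of z x] by (simp add: dist_norm)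
    qed
  qed
  ultimately show False by (rule no_nonvanishing_extension)
qed

text \<open>A polynomial path uniformly close to the loop has the same winding number. Its
  derivative is continuous, so contour integrals along it become integrals of continuous functions
  over \<open>{0..1}\<close>.\<close>

lemma polynomial_loop_around_compact_in_open:
  fixes K V :: "complex set"
  assumes K: "compact K" "K \<subseteq> V" "a \<in> K" and V: "open V"
  obtains p where "polynomial_function p" "path_image p \<subseteq> V - K" "pathfinish p = pathstart p"
    "winding_number p a \<noteq> 0"
proof -
  obtain r where r: "path r" "path_image r \<subseteq> V - K" "pathfinish r = pathstart r" "winding_number r a \<noteq> 0"
    using loop_around_compact_in_open[OF assms] by blast
  have "open (V - K)" using K(1) V by (simp add: open_Diff compact_imp_closed)
  then obtain e where e: "e > 0" "(\<Union>x\<in>path_image r. cball x e) \<subseteq> V - K"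
    using compact_subset_open_imp_cball_epsilon_subset[OF compact_path_image[OF r(1)] _ r(2)] by blast
  obtain p where p: "polynomial_function p" "pathstart p = pathstart r" "pathfinish p = pathfinish r"
    "\<And>t. t \<in> {0..1} \<Longrightarrow> norm (p t - r t) < e"
    using path_approx_polynomial_function[OF r(1) e(1)] by metis
  have "path_image p \<subseteq> (\<Union>x\<in>path_image r. cball x e)"
  proof
    fix z assume "z \<in> path_image p"
    then obtain t where t: "t \<in> {0..1}" "z = p t" by (auto simp: path_image_def)
    then have "z \<in> cball (r t) e" using p(4)[OF t(1)] by (simp add: dist_norm norm_minus_commute)
    then show "z \<in> (\<Union>x\<in>path_image r. cball x e)" using t by (auto simp: path_image_def)
  qed
  moreover have "winding_number p a = winding_number r a"
  proof (rule winding_number_nearby_paths_eq)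
    show "path p" using p(1) by (simp add: valid_path_imp_path valid_path_polynomial_function)
    fix t :: real assume t: "t \<in> {0..1}"
    have "a \<notin> cball (r t) e" using e(2) t K(3) by (force simp: path_image_def)
    then show "norm (p t - r t) < norm (r t - a)" using p(4)[OF t] by (simp add: dist_norm)
  qed (use p r in auto)
  ultimately show ?thesis using that[of p] p r e(2) by auto
qed

section \<open>Invertible bounded operators\<close>

text \<open>Only a bounded real-linear inverse is asked for, which keeps openness and continuity
  free of complex scalars; \<open>clinear_blinfun_inverse\<close> supplies complex linearity
  afterwards.\<close>

definition blinfun_unit :: "('a :: real_normed_vector \<Rightarrow>\<^sub>L 'a) \<Rightarrow> bool"
  where "blinfun_unit A \<longleftrightarrow> (\<exists>R. R o\<^sub>L A = id_blinfun \<and> A o\<^sub>L R = id_blinfun)"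

definition blinfun_inverse :: "('a :: real_normed_vector \<Rightarrow>\<^sub>L 'a) \<Rightarrow> 'a \<Rightarrow>\<^sub>L 'a"
  where "blinfun_inverse A = (THE R. R o\<^sub>L A = id_blinfun \<and> A o\<^sub>L R = id_blinfun)"

lemma blinfun_compose_simps [simp]:
  fixes A :: "'b :: real_normed_vector \<Rightarrow>\<^sub>L 'c :: real_normed_vector"
  shows "id_blinfun o\<^sub>L A = A" "A o\<^sub>L id_blinfun = A"
  by (rule blinfun_eqI, simp)+

lemma blinfun_compose_assoc:
  fixes C :: "'a :: real_normed_vector \<Rightarrow>\<^sub>L 'b :: real_normed_vector"
  shows "(A o\<^sub>L B) o\<^sub>L C = A o\<^sub>L (B o\<^sub>L C)"
  by (rule blinfun_eqI) simp

lemma blinfun_inverse_unique: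
  assumes "R o\<^sub>L A = id_blinfun" "A o\<^sub>L R = id_blinfun"
  shows "blinfun_unit A" "blinfun_inverse A = R"
proof -
  show "blinfun_unit A"
    using assms by (auto simp: blinfun_unit_def)
  show "blinfun_inverse A = R"
    unfolding blinfun_inverse_def
  proof (rule the_equality)
    fix R' assume R': "R' o\<^sub>L A = id_blinfun \<and> A o\<^sub>L R' = id_blinfun"
    have "R' = R' o\<^sub>L (A o\<^sub>L R)"
      using assms by simp
    also have "\<dots> = R"
      using R' by (simp flip: blinfun_compose_assoc)
    finally show "R' = R" .
  qed (use assms in auto)
qed

lemma blinfun_inverse:
  assumes "blinfun_unit A"
  shows "blinfun_inverse A o\<^sub>L A = id_blinfun" "A o\<^sub>L blinfun_inverse A = id_blinfun"
  using assms blinfun_inverse_unique by (auto simp: blinfun_unit_def)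

lemma blinfun_inverse_apply:
  assumes "blinfun_unit A"
  shows "blinfun_inverse A (A x) = x" "A (blinfun_inverse A x) = x"
  using blinfun_inverse[OF assms] by (metis blinfun_apply_blinfun_compose id_blinfun.rep_eq)+

lemma blinfun_unit_compose:
  assumes "blinfun_unit A" "blinfun_unit B"
  shows "blinfun_unit (A o\<^sub>L B)"
  by (rule blinfun_inverse_unique[of "blinfun_inverse B o\<^sub>L blinfun_inverse A"];
      rule blinfun_eqI; simp add: blinfun_inverse_apply assms)

section \<open>Neumann series and perturbation of inverses\<close>

lemma bounded_linear_blinfun_compose:
  fixes X :: "'a :: real_normed_vector \<Rightarrow>\<^sub>L 'a"
  shows "bounded_linear (\<lambda>Y. X o\<^sub>L Y)" "bounded_linear (\<lambda>Y. Y o\<^sub>L X)"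
  by (rule bounded_bilinear.bounded_linear_right[OF bounded_bilinear_blinfun_compose]
      bounded_bilinear.bounded_linear_left[OF bounded_bilinear_blinfun_compose])+

text \<open>The inverse is the Neumann series, which converges by comparison with a geometric
  series.\<close>

lemma blinfun_unit_id_minus:
  fixes H :: "'a :: banach \<Rightarrow>\<^sub>L 'a"
  assumes "norm H < 1"
  shows "blinfun_unit (id_blinfun - H)"
proof -
  define P where "P n = (((o\<^sub>L) H) ^^ n) id_blinfun" for n
  have P0: "P 0 = id_blinfun" and PS: "P (Suc n) = H o\<^sub>L P n" for n
    by (simp_all add: P_def)
  \<comment> \<open>The powers are built by composing on the left; commutation lets the series be
    shifted when \<open>H\<close> is composed on the right.\<close>
  have comm: "P n o\<^sub>L H = H o\<^sub>L P n" for n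
    by (induction n) (simp_all add: P0 PS blinfun_compose_assoc)
  have "norm (P n) \<le> norm H ^ n" for n
  proof (induction n)
    case 0
    show ?case by (simp add: P0 norm_blinfun_id_le)
  next
    case (Suc n)
    have "norm (P (Suc n)) \<le> norm H * norm (P n)"
      unfolding PS by (rule norm_blinfun_compose)
    also have "\<dots> \<le> norm H * norm H ^ n"
      by (rule mult_left_mono[OF Suc]) simp
    finally show ?case by simp
  qed
  then have sum: "summable P"
    by (intro summable_comparison_test'[OF summable_geometric, of "norm H" 0]) (use assms in auto)
  define N where "N = suminf P"
  have HN: "H o\<^sub>L N = (\<Sum>n. P (Suc n))"
    unfolding N_def PS by (rule bounded_linear.suminf[OF bounded_linear_blinfun_compose(1) sum])
  moreover have "N o\<^sub>L H = (\<Sum>n. P (Suc n))"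
    unfolding N_def PS using bounded_linear.suminf[OF bounded_linear_blinfun_compose(2) sum, of H] by (simp add: comm)
  moreover have "(\<Sum>n. P (Suc n)) = N - id_blinfun"
    using suminf_split_head[OF sum] by (simp add: N_def P0)
  ultimately have "H o\<^sub>L N = N - id_blinfun" "N o\<^sub>L H = N - id_blinfun" by simp_all
  then have "H (N x) = N x - x" "N (H x) = N x - x" for x
    by (metis blinfun_apply_blinfun_compose blinfun.diff_left id_blinfun.rep_eq)+
  then show ?thesis
    by (intro blinfun_inverse_unique(1)[of N]; intro blinfun_eqI; simp add: blinfun.bilinear_simps)
qed

text \<open>\<open>B\<close> factors as \<open>A\<close> times a perturbation of the identity. The
  bound \<open>1/2\<close> instead of \<open>1\<close> also makes the inverse of \<open>B\<close> at
  most twice as large as that of \<open>A\<close>, so the final estimate involves only the inverse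
  of \<open>A\<close>.\<close>

lemma blinfun_unit_perturb:
  fixes A B :: "'a :: banach \<Rightarrow>\<^sub>L 'a"
  assumes A: "blinfun_unit A" and small: "norm (B - A) * norm (blinfun_inverse A) \<le> 1/2"
  shows "blinfun_unit B"
    and "norm (blinfun_inverse B - blinfun_inverse A) \<le> 2 * norm (blinfun_inverse A) ^ 2 * norm (B - A)"
proof -
  define R where "R = blinfun_inverse A"
  note Rx [simp] = blinfun_inverse_apply[OF A, folded R_def]
  have "norm (R o\<^sub>L (A - B)) \<le> norm R * norm (A - B)"
    by (rule norm_blinfun_compose)
  then have "norm (R o\<^sub>L (A - B)) < 1"
    using small by (simp add: R_def norm_minus_commute mult.commute)
  then have "blinfun_unit (A o\<^sub>L (id_blinfun - (R o\<^sub>L (A - B))))"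
    by (intro blinfun_unit_compose A blinfun_unit_id_minus)
  moreover have "A o\<^sub>L (id_blinfun - (R o\<^sub>L (A - B))) = B"
    by (rule blinfun_eqI) (simp add: blinfun.bilinear_simps)
  ultimately show B: "blinfun_unit B" by simp
  define Q where "Q = blinfun_inverse B"
  note Qx [simp] = blinfun_inverse_apply[OF B, folded Q_def]
  \<comment> \<open>This is the resolvent identity.\<close>
  have "Q - R = Q o\<^sub>L (A - B) o\<^sub>L R"
    by (rule blinfun_eqI) (simp add: blinfun.bilinear_simps)
  then have "norm (Q - R) \<le> norm (Q o\<^sub>L (A - B)) * norm R"
    using norm_blinfun_compose[of "Q o\<^sub>L (A - B)" R] by simp
  also have "\<dots> \<le> (norm Q * norm (A - B)) * norm R"
    by (intro mult_right_mono norm_blinfun_compose) simp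
  finally have QR: "norm (Q - R) \<le> norm Q * (norm (B - A) * norm R)"
    by (simp add: norm_minus_commute mult.assoc)
  also have "\<dots> \<le> norm Q * (1/2)"
    by (rule mult_left_mono) (use small in \<open>simp_all add: R_def\<close>)
  finally have "norm Q \<le> 2 * norm R"
    using norm_triangle_sub[of Q R] by simp
  then have "norm Q * (norm (B - A) * norm R) \<le> (2 * norm R) * (norm (B - A) * norm R)"
    by (rule mult_right_mono) simp
  with QR show "norm (blinfun_inverse B - blinfun_inverse A) \<le> 2 * norm (blinfun_inverse A) ^ 2 * norm (B - A)"
    by (simp add: Q_def R_def power2_eq_square mult_ac)
qed

lemma eventually_within_perturbation_bound:
  fixes F :: "'b :: topological_space \<Rightarrow> 'a :: banach \<Rightarrow>\<^sub>L 'a"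
  assumes F: "(F \<longlongrightarrow> A) G" and A: "blinfun_unit A"
  shows "\<forall>\<^sub>F x in G. norm (F x - A) * norm (blinfun_inverse A) \<le> 1/2"
proof -
  have "((\<lambda>x. norm (F x - A) * norm (blinfun_inverse A)) \<longlongrightarrow> norm (A - A) * norm (blinfun_inverse A)) G"
    by (intro tendsto_intros F)
  then have "((\<lambda>x. norm (F x - A) * norm (blinfun_inverse A)) \<longlongrightarrow> 0) G" by simp
  from order_tendstoD(2)[OF this, of "1/2"] show ?thesis
    by (auto elim!: eventually_mono)
qed

lemma open_blinfun_unit: "open {A :: 'a :: banach \<Rightarrow>\<^sub>L 'a. blinfun_unit A}"
proof (subst open_subopen, clarify)
  fix A :: "'a \<Rightarrow>\<^sub>L 'a" assume "blinfun_unit A"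
  then have "\<forall>\<^sub>F B in nhds A. norm (B - A) * norm (blinfun_inverse A) \<le> 1/2"
    by (intro eventually_within_perturbation_bound[OF filterlim_ident])
  then have "\<forall>\<^sub>F B in nhds A. blinfun_unit B"
    by eventually_elim (rule blinfun_unit_perturb(1)[OF \<open>blinfun_unit A\<close>])
  then show "\<exists>T. open T \<and> A \<in> T \<and> T \<subseteq> {A. blinfun_unit A}"
    by (auto simp: eventually_nhds)
qed

lemma tendsto_blinfun_inverse:
  fixes F :: "'b :: topological_space \<Rightarrow> 'a :: banach \<Rightarrow>\<^sub>L 'a"
  assumes F: "(F \<longlongrightarrow> A) G" and A: "blinfun_unit A"
  shows "((\<lambda>x. blinfun_inverse (F x)) \<longlongrightarrow> blinfun_inverse A) G"
proof (rule Lim_null[THEN iffD2], rule Lim_null_comparison)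
  show "\<forall>\<^sub>F x in G. norm (blinfun_inverse (F x) - blinfun_inverse A)
      \<le> 2 * norm (blinfun_inverse A) ^ 2 * norm (F x - A)"
    using eventually_within_perturbation_bound[OF assms] by eventually_elim (rule blinfun_unit_perturb(2)[OF A])
  have "((\<lambda>x. 2 * norm (blinfun_inverse A) ^ 2 * norm (F x - A))
      \<longlongrightarrow> 2 * norm (blinfun_inverse A) ^ 2 * norm (A - A)) G"
    by (intro tendsto_intros F)
  then show "((\<lambda>x. 2 * norm (blinfun_inverse A) ^ 2 * norm (F x - A)) \<longlongrightarrow> 0) G" by simp
qed

lemma continuous_on_blinfun_inverse:
  fixes F :: "'b :: topological_space \<Rightarrow> 'a :: banach \<Rightarrow>\<^sub>L 'a"
  assumes "continuous_on S F" "\<And>x. x \<in> S \<Longrightarrow> blinfun_unit (F x)"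
  shows "continuous_on S (\<lambda>x. blinfun_inverse (F x))"
  using assms unfolding continuous_on_def by (auto intro: tendsto_blinfun_inverse)

section \<open>Complex linearity, operator pencils and the spectrum\<close>

lemma clinear_blinfun_inverse:
  fixes A :: "'a :: complex_normed_vector \<Rightarrow>\<^sub>L 'a"
  assumes A: "blinfun_unit A" and "clinear (blinfun_apply A)"
  shows "clinear (blinfun_apply (blinfun_inverse A))"
proof (rule clinearI)
  fix c x
  have "A (c *\<^sub>C blinfun_inverse A x) = c *\<^sub>C x"
    using clinearD(2)[OF assms(2)] by (simp add: blinfun_inverse_apply A)
  then show "blinfun_inverse A (c *\<^sub>C x) = c *\<^sub>C blinfun_inverse A x"
    by (metis blinfun_inverse_apply(1)[OF A])
qed (simp add: blinfun.add_right)

lemma bounded_bilinear_scaleC: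
  "bounded_bilinear (scaleC :: complex \<Rightarrow> 'a \<Rightarrow> 'a :: complex_normed_vector)"
proof
  fix a b :: complex and r :: real and x y :: 'a
  show "(a + b) *\<^sub>C x = a *\<^sub>C x + b *\<^sub>C x" "a *\<^sub>C (x + y) = a *\<^sub>C x + a *\<^sub>C y"
    by (simp_all add: scaleC_add_left scaleC_add_right)
  show "(r *\<^sub>R a) *\<^sub>C x = r *\<^sub>R a *\<^sub>C x"
    by (simp add: scaleR_scaleC[of r x] scaleR_scaleC[of r "a *\<^sub>C x"] scaleC_scaleC scaleR_conv_of_real)
  show "a *\<^sub>C r *\<^sub>R x = r *\<^sub>R a *\<^sub>C x"
    by (simp add: scaleR_scaleC[of r x] scaleR_scaleC[of r "a *\<^sub>C x"] scaleC_scaleC mult.commute)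
  show "\<exists>K. \<forall>a x. norm (a *\<^sub>C (x :: 'a)) \<le> norm a * norm x * K"
    by (rule exI[of _ 1]) (simp add: norm_scaleC)
qed

lemmas continuous_on_scaleC = bounded_bilinear.continuous_on[OF bounded_bilinear_scaleC]

lemma clinear_pencil:
  fixes B E :: "'a :: complex_normed_vector \<Rightarrow>\<^sub>L 'b :: complex_normed_vector"
  assumes "clinear (blinfun_apply B)" "clinear (blinfun_apply E)"
  shows "clinear (blinfun_apply (B - z *\<^sub>C E))"
  by (rule clinearI) (simp_all add: blinfun.bilinear_simps scaleC_blinfun.rep_eq scaleC_scaleC
      clinearD[OF assms(1)] clinearD[OF assms(2)] scaleC_add_right
      complex_vector.scale_right_diff_distrib mult.commute)

lemma clinear_id_blinfun: "clinear (blinfun_apply (id_blinfun :: 'a :: complex_normed_vector \<Rightarrow>\<^sub>L 'a))"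
  by (rule clinearI) simp_all

lemma closed_pencil_spectrum:
  fixes B E :: "'a :: {complex_normed_vector, banach} \<Rightarrow>\<^sub>L 'a"
  shows "closed {z. \<not> blinfun_unit (B - z *\<^sub>C E)}"
proof -
  have "open ((\<lambda>z. B - z *\<^sub>C E) -` {A. blinfun_unit A})"
    by (rule open_vimage[OF open_blinfun_unit]) (intro continuous_intros continuous_on_scaleC)
  then show ?thesis by (simp add: closed_def Compl_eq vimage_def)
qed

lemma spectrum_eq:
  fixes T :: "'a :: complex_normed_vector \<Rightarrow>\<^sub>L 'a"
  assumes "clinear (blinfun_apply T)"
  shows "spectrum T = {z. \<not> blinfun_unit (T - z *\<^sub>C id_blinfun)}"
proof -
  have "(\<exists>R. clinear (blinfun_apply R) \<and> R o\<^sub>L A = id_blinfun \<and> A o\<^sub>L R = id_blinfun) \<longleftrightarrow> blinfun_unit A"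
    if "clinear (blinfun_apply A)" for A :: "'a \<Rightarrow>\<^sub>L 'a"
    using clinear_blinfun_inverse[OF _ that] blinfun_inverse[of A] unfolding blinfun_unit_def by metis
  from this[OF clinear_pencil[OF assms clinear_id_blinfun]] show ?thesis
    unfolding spectrum_def by simp
qed

text \<open>Serves to trade \<open>T - z I\<close> for \<open>I - w T\<close> with
  \<open>w = 1/z\<close>, in the norm bound for the spectrum and in the case outside the
  disc.\<close>

lemma blinfun_unit_scaleC:
  fixes A :: "'a :: complex_normed_vector \<Rightarrow>\<^sub>L 'a"
  assumes "c \<noteq> 0" "clinear (blinfun_apply A)"
  shows "blinfun_unit (c *\<^sub>C A) \<longleftrightarrow> blinfun_unit A"
proof -
  have unit: "blinfun_unit (k *\<^sub>C (id_blinfun :: 'a \<Rightarrow>\<^sub>L 'a))" if "k \<noteq> 0" for k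
    by (rule blinfun_inverse_unique[of "inverse k *\<^sub>C id_blinfun"]; rule blinfun_eqI;
        use that in \<open>simp add: scaleC_blinfun.rep_eq scaleC_scaleC scaleC_one\<close>)
  have "c *\<^sub>C A = (c *\<^sub>C id_blinfun) o\<^sub>L A"
    "A = (inverse c *\<^sub>C id_blinfun) o\<^sub>L (c *\<^sub>C A)"
    by (rule blinfun_eqI, use assms(1) in \<open>simp add: scaleC_blinfun.rep_eq scaleC_scaleC scaleC_one\<close>)+
  then show ?thesis
    using blinfun_unit_compose unit assms(1) by (metis inverse_nonzero_iff_nonzero)
qed

text \<open>For larger \<open>z\<close> the Neumann series inverts \<open>I - T / z\<close>.\<close>

lemma spectrum_le_norm:
  fixes T :: "'a :: {complex_normed_vector, banach} \<Rightarrow>\<^sub>L 'a"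
  assumes "clinear (blinfun_apply T)" "z \<in> spectrum T"
  shows "cmod z \<le> norm T"
proof (rule ccontr)
  assume "\<not> cmod z \<le> norm T"
  then have z: "cmod z > norm T" "z \<noteq> 0" by auto
  have "norm (inverse z *\<^sub>C T) < 1"
    using z by (simp add: norm_scaleC norm_inverse norm_divide field_simps)
  then have u: "blinfun_unit (id_blinfun - inverse z *\<^sub>C T)" by (rule blinfun_unit_id_minus)
  have "clinear (blinfun_apply (id_blinfun - inverse z *\<^sub>C T))"
    by (rule clinear_pencil[OF clinear_id_blinfun assms(1)])
  then have "blinfun_unit ((- z) *\<^sub>C (id_blinfun - inverse z *\<^sub>C T))"
    using z(2) u by (subst blinfun_unit_scaleC) auto
  also have "(- z) *\<^sub>C (id_blinfun - inverse z *\<^sub>C T) = T - z *\<^sub>C id_blinfun"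
    unfolding complex_vector.scale_right_diff_distrib scaleC_scaleC complex_vector.scale_minus_left
    using z(2) by (simp add: scaleC_one)
  finally show False using assms by (simp add: spectrum_eq)
qed

section \<open>Contour integrals of the inverse of an operator pencil\<close>

lemma blinfun_inverse_commute:
  assumes "blinfun_unit A" "A o\<^sub>L X = X o\<^sub>L A"
  shows "blinfun_inverse A o\<^sub>L X = X o\<^sub>L blinfun_inverse A"
proof (rule blinfun_eqI)
  fix x
  have "A (X y) = X (A y)" for y
    using assms(2) by (metis blinfun_apply_blinfun_compose)
  from this[of "blinfun_inverse A x"]
  show "(blinfun_inverse A o\<^sub>L X) x = (X o\<^sub>L blinfun_inverse A) x"
    by simp (metis assms(1) blinfun_inverse_apply)
qed

lemma blinfun_compose_scaleC:
  fixes X :: "'b :: complex_normed_vector \<Rightarrow>\<^sub>L 'c :: complex_normed_vector"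
    and Y :: "'a :: complex_normed_vector \<Rightarrow>\<^sub>L 'b"
  shows "clinear (blinfun_apply X) \<Longrightarrow> X o\<^sub>L (c *\<^sub>C Y) = c *\<^sub>C (X o\<^sub>L Y)"
    "(c *\<^sub>C X) o\<^sub>L Y = c *\<^sub>C (X o\<^sub>L Y)"
  by (rule blinfun_eqI, simp add: scaleC_blinfun.rep_eq clinearD)+

lemma bounded_linear_integral_scaleC:
  fixes R :: "real \<Rightarrow> 'a :: {complex_normed_vector, banach} \<Rightarrow>\<^sub>L 'a"
  assumes "continuous_on {0..1} \<phi>" "continuous_on {0..1} R" "bounded_linear h"
  shows "h (integral {0..1} (\<lambda>t. \<phi> t *\<^sub>C R t)) = integral {0..1} (\<lambda>t. h (\<phi> t *\<^sub>C R t))"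
  using integral_linear[OF integrable_continuous_real assms(3), of 0 1 "\<lambda>t. \<phi> t *\<^sub>C R t"]
    continuous_on_scaleC[OF assms(1,2)] by (simp add: o_def)

text \<open>\<open>T n\<close> is the contour integral of \<open>z ^ n\<close> times the inverse of \<open>B - z *\<^sub>C E\<close> along a loop around a
  point \<open>a \<in> K\<close>. If \<open>E o\<^sub>L T 0\<close> vanished, then integrating with the kernel \<open>1 / (z - a)\<close> instead
  would give an inverse of \<open>B - a *\<^sub>C E\<close> up to the factor \<open>2 * pi * \<i>\<close> times the winding number.\<close>

lemma pencil_moments:
  fixes B E :: "'a :: {complex_normed_vector, banach} \<Rightarrow>\<^sub>L 'a"
  defines "Sp \<equiv> {z. \<not> blinfun_unit (B - z *\<^sub>C E)}"
  assumes lin: "clinear (blinfun_apply B)" "clinear (blinfun_apply E)"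
    and BE: "B o\<^sub>L E = E o\<^sub>L B"
    and K: "compact K" "K \<noteq> {}" "K \<subseteq> Sp" "K \<subseteq> ball 0 1" "closed (Sp - K)"
  obtains T :: "nat \<Rightarrow> 'a \<Rightarrow>\<^sub>L 'a"
  where "\<forall>n. clinear (blinfun_apply (T n))"
    and "\<forall>n. B o\<^sub>L T n = E o\<^sub>L T (Suc n)"
    and "\<forall>n. T n o\<^sub>L B = B o\<^sub>L T n" "\<forall>n. T n o\<^sub>L E = E o\<^sub>L T n"
    and "T \<longlonglongrightarrow> 0" "E o\<^sub>L T 0 \<noteq> 0"
proof -
  define A where "A z = B - z *\<^sub>C E" for z
  obtain a where a: "a \<in> K" using K(2) by auto
  \<comment> \<open>\<open>V\<close> is open because \<open>Sp - K\<close> is closed. A loop in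
    \<open>V - K\<close> stays in the disc and misses all of \<open>Sp\<close>.\<close>
  define V where "V = ball 0 1 - (Sp - K)"
  have "open V" "K \<subseteq> V" using K by (auto simp: V_def)
  then obtain p where p: "polynomial_function p" "path_image p \<subseteq> V - K" "pathfinish p = pathstart p"
    "winding_number p a \<noteq> 0"
    using polynomial_loop_around_compact_in_open[OF K(1) _ a] by metis
  have vp: "valid_path p" using p(1) by (rule valid_path_polynomial_function)
  have pt: "cmod (p t) < 1" "blinfun_unit (A (p t))" "p t \<noteq> a" if "t \<in> {0..1}" for t
  proof -
    have "p t \<in> V - K" using subsetD[OF p(2), of "p t"] that by (simp add: path_image_def)
    then show "cmod (p t) < 1" "blinfun_unit (A (p t))" "p t \<noteq> a"
      using a by (auto simp: V_def Sp_def A_def)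
  qed
  have ap: "a \<notin> path_image p" using p(2) a by blast
  obtain p' where p': "polynomial_function p'" "\<And>t. (p has_vector_derivative p' t) (at t)"
    using has_vector_derivative_polynomial_function[OF p(1)] by metis
  have vd: "vector_derivative p (at t) = p' t" for t
    using p'(2) by (rule vector_derivative_at)
  have pc: "continuous_on S p" "continuous_on S p'" for S
    using p(1) p'(1) by (simp_all add: continuous_on_polymonial_function)
  define R where "R t = blinfun_inverse (A (p t))" for t
  have Rc: "continuous_on {0..1} R"
    unfolding R_def
    by (rule continuous_on_blinfun_inverse)
      (auto simp: A_def intro!: continuous_intros continuous_on_scaleC pc pt(2)[unfolded A_def])
  define J where "J \<phi> = integral {0..1} (\<lambda>t. \<phi> t *\<^sub>C R t)" for \<phi>
  have J_linear: "h (J \<phi>) = integral {0..1} (\<lambda>t. h (\<phi> t *\<^sub>C R t))"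
    if "continuous_on {0..1} \<phi>" "bounded_linear h" for \<phi> and h :: "('a \<Rightarrow>\<^sub>L 'a) \<Rightarrow> ('a \<Rightarrow>\<^sub>L 'a)"
    unfolding J_def by (rule bounded_linear_integral_scaleC[OF that(1) Rc that(2)])
  have lin_op: "bounded_linear ((o\<^sub>L) X :: _ \<Rightarrow> 'a \<Rightarrow>\<^sub>L 'a)" "bounded_linear (\<lambda>Y. Y o\<^sub>L X)"
    for X :: "'a \<Rightarrow>\<^sub>L 'a"
    by (rule bounded_linear_blinfun_compose)+
  \<comment> \<open>This rearranges \<open>(B - z E) R = I\<close> at \<open>z = p t\<close>: up to
    an identity term, \<open>B\<close> acts on the inverse as \<open>p t\<close> times
    \<open>E\<close>.\<close>
  have BR: "B o\<^sub>L R t = id_blinfun + p t *\<^sub>C (E o\<^sub>L R t)" if "t \<in> {0..1}" for t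
  proof (rule blinfun_eqI)
    fix x
    have "A (p t) (R t x) = x"
      unfolding R_def by (rule blinfun_inverse_apply(2)[OF pt(2)[OF that]])
    then show "(B o\<^sub>L R t) x = (id_blinfun + p t *\<^sub>C (E o\<^sub>L R t)) x"
      by (simp add: A_def blinfun.bilinear_simps scaleC_blinfun.rep_eq algebra_simps)
  qed
  \<comment> \<open>Whatever commutes with both coefficients of the pencil commutes with its
    inverses, hence with their integrals.\<close>
  have J_comm: "J \<phi> o\<^sub>L X = X o\<^sub>L J \<phi>"
    if X: "clinear (blinfun_apply X)" "B o\<^sub>L X = X o\<^sub>L B" "E o\<^sub>L X = X o\<^sub>L E"
      and \<phi>: "continuous_on {0..1} \<phi>" for X \<phi>
  proof -
    have "(\<phi> t *\<^sub>C R t) o\<^sub>L X = X o\<^sub>L (\<phi> t *\<^sub>C R t)" if t: "t \<in> {0..1}" for t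
    proof -
      have "A (p t) o\<^sub>L X = X o\<^sub>L A (p t)"
      proof (rule blinfun_eqI)
        fix x
        have "B (X x) = X (B x)" "E (X x) = X (E x)"
          using X(2,3) by (metis blinfun_apply_blinfun_compose)+
        then show "(A (p t) o\<^sub>L X) x = (X o\<^sub>L A (p t)) x"
          by (simp add: A_def blinfun.bilinear_simps scaleC_blinfun.rep_eq clinearD[OF X(1)])
      qed
      then have "R t o\<^sub>L X = X o\<^sub>L R t"
        unfolding R_def by (rule blinfun_inverse_commute[OF pt(2)[OF t]])
      then show ?thesis by (simp add: blinfun_compose_scaleC X(1))
    qed
    then show ?thesis
      unfolding J_linear[OF \<phi> lin_op(1)] J_linear[OF \<phi> lin_op(2)] by (rule integral_cong)
  qed
  have J_clinear: "clinear (blinfun_apply (J \<phi>))" if \<phi>: "continuous_on {0..1} \<phi>" for \<phi>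
  proof (rule clinearI)
    fix c x
    have R_lin: "R t (c *\<^sub>C y) = c *\<^sub>C R t y" if "t \<in> {0..1}" for t y
      unfolding R_def using clinearD(2)[OF clinear_blinfun_inverse[OF pt(2)[OF that]]] clinear_pencil[OF lin]
      by (simp add: A_def)
    have J_apply: "((\<lambda>t. \<phi> t *\<^sub>C R t y) has_integral J \<phi> y) {0..1}" for y
    proof -
      have "((\<lambda>t. \<phi> t *\<^sub>C R t) has_integral J \<phi>) {0..1}"
        unfolding J_def
        by (intro integrable_integral integrable_continuous_real continuous_on_scaleC \<phi> Rc)
      from has_integral_linear[OF this bounded_linear_apply_blinfun, of y] show ?thesis
        by (simp add: o_def scaleC_blinfun.rep_eq)
    qed
    have "((\<lambda>t. \<phi> t *\<^sub>C R t (c *\<^sub>C x)) has_integral c *\<^sub>C J \<phi> x) {0..1}"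
      using has_integral_linear[OF J_apply[of x] bounded_linear_scaleC[of c]]
      by (rule has_integral_eq[rotated]) (simp add: R_lin scaleC_scaleC mult.commute)
    then show "J \<phi> (c *\<^sub>C x) = c *\<^sub>C J \<phi> x"
      using J_apply has_integral_unique by blast
  qed (simp add: blinfun.add_right)
  \<comment> \<open>Integrating \<open>BR\<close> leaves a scalar \<open>i\<close>. It is 0 for the
    moments \<open>T n\<close> and nonzero for the Cauchy kernel used at the end.\<close>
  have B_J: "B o\<^sub>L J \<phi> = i *\<^sub>C id_blinfun + (E o\<^sub>L J (\<lambda>t. \<phi> t * p t))"
    if \<phi>: "continuous_on {0..1} \<phi>" and i: "(\<phi> has_integral i) {0..1}" for \<phi> i
  proof -
    have \<phi>p: "continuous_on {0..1} (\<lambda>t. \<phi> t * p t)"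
      by (intro continuous_intros \<phi> pc)
    have "B o\<^sub>L (\<phi> t *\<^sub>C R t) = \<phi> t *\<^sub>C id_blinfun + (E o\<^sub>L ((\<phi> t * p t) *\<^sub>C R t))"
      if "t \<in> {0..1}" for t
      using BR[OF that] by (simp add: blinfun_compose_scaleC lin scaleC_add_right scaleC_scaleC)
    then have "B o\<^sub>L J \<phi> = integral {0..1} (\<lambda>t. \<phi> t *\<^sub>C id_blinfun + (E o\<^sub>L ((\<phi> t * p t) *\<^sub>C R t)))"
      unfolding J_linear[OF \<phi> lin_op(1)] by (rule integral_cong)
    also have "\<dots> = integral {0..1} (\<lambda>t. \<phi> t *\<^sub>C id_blinfun)
        + integral {0..1} (\<lambda>t. E o\<^sub>L ((\<phi> t * p t) *\<^sub>C R t))"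
      by (intro Henstock_Kurzweil_Integration.integral_add integrable_continuous_real
          continuous_on_scaleC continuous_intros \<phi>
          bounded_linear.continuous_on[OF lin_op(1)] \<phi>p Rc)
    also have "integral {0..1} (\<lambda>t. \<phi> t *\<^sub>C (id_blinfun :: 'a \<Rightarrow>\<^sub>L 'a)) = i *\<^sub>C id_blinfun"
      using has_integral_linear[OF i bounded_bilinear.bounded_linear_left[OF bounded_bilinear_scaleC]]
      by (intro integral_unique) (simp add: o_def)
    finally show ?thesis unfolding J_linear[OF \<phi>p lin_op(1)] .
  qed
  define T where "T n = J (\<lambda>t. p' t * p t ^ n)" for n
  have Tc: "continuous_on {0..1} (\<lambda>t. p' t * p t ^ n)" for n
    by (intro continuous_intros pc)
  \<comment> \<open>Powers have primitives, so the identity term disappears from the recursion for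
    \<open>T\<close>.\<close>
  have int_power: "((\<lambda>t. p' t * p t ^ n) has_integral 0) {0..1}" for n
  proof -
    have "((\<lambda>z. z ^ n) has_contour_integral 0) p"
    proof (rule Cauchy_theorem_primitive[OF _ vp subset_UNIV p(3)])
      show "((\<lambda>z. z ^ Suc n / of_nat (Suc n)) has_field_derivative x ^ n) (at x)" for x :: complex
        by (rule derivative_eq_intros refl | simp add: field_simps del: of_nat_Suc)+
    qed
    then show ?thesis by (simp add: has_contour_integral vd mult.commute)
  qed
  have step: "B o\<^sub>L T n = E o\<^sub>L T (Suc n)" for n
    using B_J[OF Tc int_power, of n] by (simp add: T_def mult_ac)
  have comm: "T n o\<^sub>L B = B o\<^sub>L T n" "T n o\<^sub>L E = E o\<^sub>L T n" for n
    unfolding T_def by (intro J_comm lin BE BE[symmetric] refl Tc)+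
  have "T \<longlonglongrightarrow> 0"
  proof -
    \<comment> \<open>By compactness the modulus has a maximum on the loop, attained at
      \<open>t0\<close>; it is below 1 and gives geometric decay.\<close>
    obtain t0 where t0: "t0 \<in> {0..1}" "\<And>t. t \<in> {0..1} \<Longrightarrow> cmod (p t) \<le> cmod (p t0)"
      using continuous_attains_sup[of "{0..1::real}" "\<lambda>t. cmod (p t)"] continuous_on_norm[OF pc(1)] by auto
    have "compact ((\<lambda>t. p' t *\<^sub>C R t) ` {0..1})"
      by (intro compact_continuous_image continuous_on_scaleC pc Rc) simp
    from compact_imp_bounded[OF this] obtain M where "\<forall>t\<in>{0..1}. norm (p' t *\<^sub>C R t) \<le> M"
      by (auto simp: bounded_iff)
    then have M: "norm (p' t *\<^sub>C R t) \<le> M" if "t \<in> {0..1}" for t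
      using that by blast
    have "0 \<le> M" using M[OF t0(1)] by (rule order_trans[OF norm_ge_zero])
    have "norm (T n) \<le> M * cmod (p t0) ^ n" for n
    proof -
      have "norm (T n) \<le> (M * cmod (p t0) ^ n) * (1 - 0)"
        unfolding T_def J_def
      proof (rule integral_bound)
        fix t :: real assume t: "t \<in> {0..1}"
        have "norm ((p' t * p t ^ n) *\<^sub>C R t) = norm (p' t *\<^sub>C R t) * cmod (p t) ^ n"
          by (simp add: norm_scaleC norm_mult norm_power)
        also have "\<dots> \<le> M * cmod (p t0) ^ n"
          using \<open>0 \<le> M\<close> by (intro mult_mono power_mono M[OF t] t0(2)[OF t]) auto
        finally show "norm ((p' t * p t ^ n) *\<^sub>C R t) \<le> M * cmod (p t0) ^ n" .
      qed (auto intro: continuous_on_scaleC Tc Rc)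
      then show ?thesis by simp
    qed
    moreover have "(\<lambda>n. M * cmod (p t0) ^ n) \<longlonglongrightarrow> 0"
      using pt(1)[OF t0(1)] by (intro tendsto_mult_right_zero LIMSEQ_power_zero) simp
    ultimately show ?thesis
      by (rule Lim_null_comparison[OF always_eventually[OF allI]])
  qed
  moreover have "E o\<^sub>L T 0 \<noteq> 0"
  proof
    assume E0: "E o\<^sub>L T 0 = 0"
    \<comment> \<open>The Cauchy kernel at \<open>a\<close> pulled back along the loop. Its integral
      \<open>i\<close> is nonzero since the loop winds around \<open>a\<close>.\<close>
    define \<phi> where "\<phi> t = p' t / (p t - a)" for t
    define i where "i = 2 * of_real pi * \<i> * winding_number p a"
    have i0: "i \<noteq> 0" using p(4) by (simp add: i_def)
    have \<phi>c: "continuous_on {0..1} \<phi>"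
      unfolding \<phi>_def using pt(3) by (intro continuous_intros pc) auto
    have "((\<lambda>z. 1 / (z - a)) has_contour_integral i) p"
      using has_contour_integral_winding_number[OF vp ap] by (simp add: i_def)
    then have \<phi>i: "(\<phi> has_integral i) {0..1}"
      by (simp add: has_contour_integral vd \<phi>_def[abs_def])
    define Q where "Q = J \<phi>"
    \<comment> \<open>This is \<open>z / (z - a) - a / (z - a) = 1\<close>, integrated against the
      inverse pencil.\<close>
    have "J (\<lambda>t. \<phi> t * p t) - a *\<^sub>C Q = T 0"
    proof -
      have "T 0 = integral {0..1} (\<lambda>t. (\<phi> t * p t) *\<^sub>C R t - a *\<^sub>C \<phi> t *\<^sub>C R t)"
        unfolding T_def J_def
      proof (rule integral_cong)
        fix t :: real assume "t \<in> {0..1}"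
        then have "\<phi> t * (p t - a) = p' t"
          using pt(3)[of t] by (simp add: \<phi>_def)
        then have "p' t = \<phi> t * p t - a * \<phi> t"
          by (simp add: algebra_simps)
        then show "(p' t * p t ^ 0) *\<^sub>C R t = (\<phi> t * p t) *\<^sub>C R t - a *\<^sub>C \<phi> t *\<^sub>C R t"
          by (simp add: scaleC_scaleC complex_vector.scale_left_diff_distrib)
      qed
      also have "\<dots> = J (\<lambda>t. \<phi> t * p t) - integral {0..1} (\<lambda>t. a *\<^sub>C \<phi> t *\<^sub>C R t)"
        unfolding J_def
        by (intro Henstock_Kurzweil_Integration.integral_diff integrable_continuous_real
            continuous_on_scaleC continuous_intros \<phi>c pc Rc)
      also have "integral {0..1} (\<lambda>t. a *\<^sub>C \<phi> t *\<^sub>C R t) = a *\<^sub>C Q"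
        unfolding Q_def by (rule J_linear[OF \<phi>c bounded_linear_scaleC, symmetric])
      finally show ?thesis by simp
    qed
    then have "E o\<^sub>L J (\<lambda>t. \<phi> t * p t) = E o\<^sub>L (T 0 + a *\<^sub>C Q)" by (metis diff_add_cancel)
    also have "\<dots> = a *\<^sub>C (E o\<^sub>L Q)"
      using E0 by (simp add: linear_simps(1)[OF lin_op(1)] blinfun_compose_scaleC lin)
    finally have BQ: "B o\<^sub>L Q = i *\<^sub>C id_blinfun + a *\<^sub>C (E o\<^sub>L Q)"
      using B_J[OF \<phi>c \<phi>i] by (simp add: Q_def)
    have QB: "Q o\<^sub>L B = B o\<^sub>L Q" "Q o\<^sub>L E = E o\<^sub>L Q"
      unfolding Q_def by (intro J_comm lin BE BE[symmetric] refl \<phi>c)+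
    have Qlin: "clinear (blinfun_apply Q)"
      unfolding Q_def by (rule J_clinear[OF \<phi>c])
    have BQx: "B (Q x) = i *\<^sub>C x + a *\<^sub>C E (Q x)" "Q (B x) = B (Q x)" "Q (E x) = E (Q x)" for x
      using arg_cong[OF BQ, of "\<lambda>X. blinfun_apply X x"] arg_cong[OF QB(1), of "\<lambda>X. blinfun_apply X x"]
        arg_cong[OF QB(2), of "\<lambda>X. blinfun_apply X x"]
      by (simp_all add: blinfun.bilinear_simps scaleC_blinfun.rep_eq)
    \<comment> \<open>\<open>BQ\<close> makes \<open>Q / i\<close> a right inverse; as
      \<open>Q\<close> commutes with \<open>B\<close> and \<open>E\<close>, it is a left inverse
      too. So \<open>a\<close> would not be in \<open>Sp\<close>.\<close>
    have "blinfun_unit (B - a *\<^sub>C E)"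
      by (rule blinfun_inverse_unique[of "inverse i *\<^sub>C Q"]; rule blinfun_eqI;
          use i0 in \<open>simp add: blinfun.bilinear_simps scaleC_blinfun.rep_eq BQx
            clinearD[OF lin(1)] clinearD[OF lin(2)] clinearD[OF Qlin] scaleC_add_right scaleC_scaleC
            scaleC_one complex_vector.scale_right_diff_distrib mult.commute\<close>)
    then show False using a K(3) by (auto simp: Sp_def)
  qed
  ultimately show ?thesis
    using that[of T] step comm J_clinear[OF Tc] by (simp add: T_def)
qed

section \<open>Transitive maps and the Lipschitz-free space\<close>

text \<open>The preimage of \<open>V\<close> under the \<open>N\<close>-th iterate is again open and
  nonempty, and reaching it after \<open>n\<close> steps means reaching \<open>V\<close> after
  \<open>N + n\<close>.\<close>

lemma topologically_transitive_late:
  assumes f: "topologically_transitive f" and "open U" "U \<noteq> {}" "open V" "V \<noteq> {}"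
  obtains m u where "m \<ge> N" "u \<in> U" "(f ^^ m) u \<in> V"
proof -
  have tr: "\<exists>n\<ge>1. (f ^^ n) ` U \<inter> V \<noteq> {}" if "open U" "U \<noteq> {}" "open V" "V \<noteq> {}" for U V
    using f that unfolding topologically_transitive_def by blast
  have "open ((f ^^ N) -` V) \<and> (f ^^ N) -` V \<noteq> {}"
    using assms(4,5)
  proof (induction N arbitrary: V)
    case (Suc N)
    \<comment> \<open>As \<open>n \<ge> 1\<close>, one application of \<open>f\<close> splits off,
      so some point of \<open>V\<close> is a value of \<open>f\<close>.\<close>
    obtain n x where "n \<ge> 1" "(f ^^ n) x \<in> V"
      using tr[of UNIV V] Suc.prems by blast
    then have "f ((f ^^ (n - 1)) x) \<in> V"
      by (cases n) auto
    then have "f -` V \<noteq> {}" by auto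
    moreover have "open (f -` V)"
      using f Suc.prems(1) by (intro open_vimage) (auto simp: topologically_transitive_def)
    ultimately have "open ((f ^^ N) -` (f -` V)) \<and> (f ^^ N) -` (f -` V) \<noteq> {}"
      by (intro Suc.IH)
    then show ?case by (simp add: vimage_def)
  qed simp
  then obtain n u where "u \<in> U" "(f ^^ N) ((f ^^ n) u) \<in> V"
    using tr[of U "(f ^^ N) -` V"] assms(2,3) by blast
  then show ?thesis
    using that[of "N + n" u] by (simp add: funpow_add)
qed

section \<open>Point evaluations and operators vanishing on them\<close>

lemma norm_free_dirac_diff_le: "norm (free_dirac x - free_dirac y) \<le> dist x y"
  unfolding norm_lipschitz_free.rep_eq minus_lipschitz_free.rep_eq free_dirac.rep_eq
proof (rule norm_blinfun_bound)
  fix g :: "'a lip0"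
  show "norm ((dirac x - dirac y) g) \<le> dist x y * norm g"
    using lipschitz_onD[OF lip0_lipschitz, of x y g]
    by (simp add: dirac.rep_eq blinfun.diff_left dist_norm mult.commute)
qed simp

lemma free_dirac_basepoint: "free_dirac basepoint = (0 :: 'a :: pointed_metric_space lipschitz_free)"
proof -
  have "dirac basepoint = (0 :: 'a lip0 \<Rightarrow>\<^sub>L complex)"
    by (rule blinfun_eqI) (simp add: dirac.rep_eq)
  then show ?thesis
    by (simp add: free_dirac.rep_eq zero_lipschitz_free.rep_eq flip: free_functional_inject)
qed

lemma norm_free_dirac_le: "norm (free_dirac x) \<le> dist x basepoint"
  using norm_free_dirac_diff_le[of x basepoint] by (simp add: free_dirac_basepoint)

text \<open>Evaluation at the base point is 0, so both \<open>T\<close> and 0 are operators induced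
  by the constant map to the base point. Uniqueness of that operator contains the density
  argument.\<close>

lemma eq_zero_if_zero_on_free_dirac:
  fixes T :: "'a :: pointed_metric_space lipschitz_free \<Rightarrow>\<^sub>L 'a lipschitz_free"
  assumes "clinear (blinfun_apply T)" "\<And>x. T (free_dirac x) = 0"
  shows "T = 0"
proof -
  have "0-lipschitz_on UNIV (\<lambda>_ :: 'a. basepoint :: 'a)"
    by (rule lipschitz_on_constant)
  note the_eq = the1_equality[OF ex1_lipschitz_op[OF this refl]]
  have "clinear (blinfun_apply (0 :: 'a lipschitz_free \<Rightarrow>\<^sub>L 'a lipschitz_free))"
    by (rule clinearI) simp_all
  then show ?thesis
    using the_eq[of T] the_eq[of 0] assms by (simp add: free_dirac_basepoint)
qed

text \<open>The values \<open>T m (free_dirac u)\<close> are small because \<open>u\<close> stays in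
  a fixed ball while \<open>T m\<close> tends to 0. They equal \<open>P\<close> at evaluations close
  to that at \<open>y\<close>, and \<open>P\<close> is continuous.\<close>

lemma zero_on_free_dirac_if_recurrent:
  fixes T :: "nat \<Rightarrow> 'a :: pointed_metric_space lipschitz_free \<Rightarrow>\<^sub>L 'a lipschitz_free"
    and P :: "'a lipschitz_free \<Rightarrow>\<^sub>L 'a lipschitz_free"
  assumes T: "T \<longlonglongrightarrow> 0"
    and rec: "\<And>e N. e > 0 \<Longrightarrow> \<exists>m\<ge>N. \<exists>u v. dist v y < e \<and> dist u basepoint < 1 \<and>
      P (free_dirac v) = T m (free_dirac u)"
  shows "P (free_dirac y) = 0"
proof (rule ccontr)
  assume "P (free_dirac y) \<noteq> 0"
  \<comment> \<open>Chosen so that \<open>(norm P + 1) * e\<close> is half of the norm to be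
    refuted.\<close>
  define e where "e = norm (P (free_dirac y)) / (2 * (norm P + 1))"
  have p: "norm P + 1 > 0" using norm_ge_zero[of P] by linarith
  then have e: "e > 0" using \<open>P (free_dirac y) \<noteq> 0\<close> by (simp add: e_def)
  obtain N where N: "\<And>m. m \<ge> N \<Longrightarrow> norm (T m) < e"
    using T e by (auto simp: LIMSEQ_iff)
  obtain m u v where m: "m \<ge> N" "dist v y < e" "dist u basepoint < 1" "P (free_dirac v) = T m (free_dirac u)"
    using rec[OF e, of N] by blast
  have "norm (P (free_dirac y)) \<le> norm (P (free_dirac y - free_dirac v)) + norm (T m (free_dirac u))"
    using norm_triangle_ineq[of "P (free_dirac y - free_dirac v)" "P (free_dirac v)"] m(4)
    by (simp add: blinfun.diff_right)
  also have "\<dots> \<le> norm P * norm (free_dirac y - free_dirac v) + norm (T m) * norm (free_dirac u)"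
    by (intro add_mono norm_blinfun)
  also have "\<dots> \<le> norm P * e + e * 1"
    using norm_free_dirac_diff_le[of y v] norm_free_dirac_le[of u] m N[OF m(1)] e
    by (intro add_mono mult_mono) (auto simp: dist_commute)
  also have "\<dots> = (norm P + 1) * e"
    by (simp add: distrib_right)
  also have "\<dots> = norm (P (free_dirac y)) / 2"
  proof -
    have "q * (x / (2 * q)) = x / 2" if "q > 0" for q x :: real using that by simp
    then show ?thesis unfolding e_def using p by blast
  qed
  finally show False using \<open>P (free_dirac y) \<noteq> 0\<close> by simp
qed

text \<open>Being connected, \<open>C\<close> lies on one side of the circle. It need not be
  relatively open in \<open>S\<close>, so the Sura-Bura theorem encloses it in a compact relatively
  open piece on the same side.\<close>

lemma component_avoiding_sphere:
  fixes S :: "complex set"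
  assumes "closed S" "bounded S" "C \<in> components S" "C \<inter> {z. cmod z = 1} = {}"
  obtains K where "compact K" "K \<noteq> {}" "openin (top_of_set S) K"
    "K \<subseteq> ball 0 1 \<or> K \<subseteq> - cball 0 1"
proof -
  have C: "connected C" "C \<noteq> {}" "C \<subseteq> S" "closed C"
    using assms by (auto dest: in_components_connected in_components_nonempty in_components_subset
        intro: closed_components)
  then have "compact C"
    using assms(2) bounded_subset compact_eq_bounded_closed by blast
  have "C \<subseteq> ball 0 1 \<or> C \<subseteq> - cball 0 1"
  proof -
    have "C \<subseteq> ball 0 1 \<union> - cball 0 1" using assms(4) by force
    moreover have "ball 0 1 \<inter> - cball 0 1 \<inter> C = {}" by auto
    ultimately have "ball 0 1 \<inter> C = {} \<or> - cball 0 1 \<inter> C = {}"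
      using connectedD[OF C(1), of "ball 0 1" "- cball 0 1"] by auto
    with \<open>C \<subseteq> ball 0 1 \<union> - cball 0 1\<close> show ?thesis by blast
  qed
  then obtain U where U: "open U" "C \<subseteq> U" "U = ball 0 1 \<or> U = - cball 0 1"
    by (metis open_ball open_Compl closed_cball)
  obtain K where "openin (top_of_set S) K" "compact K" "C \<subseteq> K" "K \<subseteq> U"
    using Sura_Bura_clopen_subset[OF closed_imp_locally_compact[OF assms(1)] assms(3) \<open>compact C\<close> U(1,2)]
    by blast
  then show ?thesis using that[of K] U(3) C(2) by blast
qed

lemma closed_diff_relatively_open:
  assumes "closed S" "openin (top_of_set S) K"
  shows "closed (S - K)"
proof -
  have "closedin (top_of_set S) (S - K)" using assms(2) by (auto intro: closedin_diff)
  then show ?thesis using assms(1) closedin_closed_trans by blast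
qed

theorem theorem3p7:
  fixes f :: "'a :: {pointed_metric_space, complete_space} \<Rightarrow> 'a"
  assumes "separable_space (euclidean :: 'a topology)"
    and "\<exists>x y :: 'a. x \<noteq> y"
    and "\<exists>L. L-lipschitz_on UNIV f"
    and "f basepoint = basepoint"
    and "topologically_transitive f"
  shows "\<forall>C \<in> components (spectrum (lipschitz_op f)). C \<inter> {z. cmod z = 1} \<noteq> {}"
proof (intro ballI notI)
  fix C assume C: "C \<in> components (spectrum (lipschitz_op f))" "C \<inter> {z. cmod z = 1} = {}"
  define S where "S = lipschitz_op f"
  obtain L where L: "L-lipschitz_on UNIV f" using assms(3) by blast
  note S = lipschitz_op[OF L assms(4), folded S_def]
  note id = clinear_id_blinfun
  have Seq: "spectrum S = {z. \<not> blinfun_unit (S - z *\<^sub>C id_blinfun)}"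
    by (rule spectrum_eq[OF S(1)])
  have cl: "closed (spectrum S)"
    unfolding Seq by (rule closed_pencil_spectrum)
  have "bounded (spectrum S)"
    using spectrum_le_norm[OF S(1)] by (auto intro: boundedI)
  from component_avoiding_sphere[OF cl this C[folded S_def]]
  obtain K where K: "compact K" "K \<noteq> {}" "openin (top_of_set (spectrum S)) K"
    "K \<subseteq> ball 0 1 \<or> K \<subseteq> - cball 0 1"
    by blast
  have KS: "K \<subseteq> spectrum S" using K(3) openin_imp_subset by blast
  from K(4) show False
  proof
    assume Kb: "K \<subseteq> ball 0 1"
    have comm: "S o\<^sub>L id_blinfun = id_blinfun o\<^sub>L S" by simp
    obtain T where T': "\<forall>n. clinear (blinfun_apply (T n))" "\<forall>n. S o\<^sub>L T n = id_blinfun o\<^sub>L T (Suc n)"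
      "\<forall>n. T n o\<^sub>L S = S o\<^sub>L T n" "\<forall>n. T n o\<^sub>L id_blinfun = id_blinfun o\<^sub>L T n"
      "T \<longlonglongrightarrow> 0" "id_blinfun o\<^sub>L T 0 \<noteq> 0"
      by (rule pencil_moments[OF S(1) id comm K(1,2) KS[unfolded Seq] Kb
          closed_diff_relatively_open[OF cl K(3), unfolded Seq]])
    note T = T'[rule_format]
    \<comment> \<open>Commutation turns \<open>S T n = T (n+1)\<close> into
      \<open>T (n+1) = T n S\<close>, so \<open>T n\<close> is \<open>T 0\<close> after
      \<open>n\<close> applications of \<open>S\<close>.\<close>
    have iter: "T n (free_dirac u) = T 0 (free_dirac ((f ^^ n) u))" for n u
    proof (induction n arbitrary: u)
      case (Suc n)
      have "T (Suc n) = T n o\<^sub>L S" using T(2,3)[of n] by simp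
      then show ?case using Suc[of "f u"] by (simp add: S funpow_swap1)
    qed simp
    have "T 0 (free_dirac y) = 0" for y
    proof (rule zero_on_free_dirac_if_recurrent[OF T(5)])
      \<comment> \<open>Here the orbit starts near the base point and arrives near
        \<open>y\<close>.\<close>
      fix e :: real and N :: nat assume "e > 0"
      then obtain m u where "m \<ge> N" "u \<in> ball basepoint 1" "(f ^^ m) u \<in> ball y e"
        using topologically_transitive_late[OF assms(5), of "ball basepoint 1" "ball y e" N] by auto
      then show "\<exists>m\<ge>N. \<exists>u v. dist v y < e \<and> dist u basepoint < 1 \<and> T 0 (free_dirac v) = T m (free_dirac u)"
        using iter by (intro exI[of _ m] conjI exI[of _ u] exI[of _ "(f ^^ m) u"]) (auto simp: dist_commute)
    qed
    with T(1,6) eq_zero_if_zero_on_free_dirac show False by auto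
  next
    assume Ke: "K \<subseteq> - cball 0 1"
    \<comment> \<open>Away from 0 this is the image of the spectrum under
      \<open>z \<mapsto> 1/z\<close>; 0 itself is not in it, since the pencil is the identity
      there.\<close>
    define W where "W = {w. \<not> blinfun_unit (id_blinfun - w *\<^sub>C S)}"
    have clW: "closed W" unfolding W_def by (rule closed_pencil_spectrum)
    have "blinfun_unit (id_blinfun :: 'a lipschitz_free \<Rightarrow>\<^sub>L _)"
      by (rule blinfun_inverse_unique[of id_blinfun]) simp_all
    then have W0: "0 \<notin> W" by (simp add: W_def)
    have W: "w \<in> W \<longleftrightarrow> inverse w \<in> spectrum S" if "w \<noteq> 0" for w
    proof -
      have "id_blinfun - w *\<^sub>C S = (- w) *\<^sub>C (S - inverse w *\<^sub>C id_blinfun)"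
        unfolding complex_vector.scale_right_diff_distrib scaleC_scaleC complex_vector.scale_minus_left
        using that by (simp add: scaleC_one)
      moreover have "clinear (blinfun_apply (S - inverse w *\<^sub>C id_blinfun))"
        by (rule clinear_pencil[OF S(1) clinear_id_blinfun])
      ultimately show ?thesis
        using that blinfun_unit_scaleC[of "- w" "S - inverse w *\<^sub>C id_blinfun"]
        by (simp only: W_def Seq mem_Collect_eq neg_equal_0_iff_equal) simp
    qed
    have K0: "0 \<notin> K" using Ke by auto
    define K' where "K' = inverse ` K"
    have K'W: "K' \<subseteq> W" 
    proof
      fix w assume "w \<in> K'"
      then obtain z where "z \<in> K" "w = inverse z" by (auto simp: K'_def)
      moreover from \<open>z \<in> K\<close> have "z \<noteq> 0" "z \<in> spectrum S" using K0 KS by auto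
      ultimately show "w \<in> W" using W[of w] by simp
    qed
    have K'c: "compact K'" unfolding K'_def
      using K0 by (intro compact_continuous_image K(1) continuous_intros) auto
    have K'b: "K' \<subseteq> ball 0 1"
    proof
      fix w assume "w \<in> K'"
      then obtain z where "z \<in> K" "w = inverse z" by (auto simp: K'_def)
      moreover from subsetD[OF Ke \<open>z \<in> K\<close>] have "cmod z > 1" by simp
      ultimately show "w \<in> ball 0 1" by (simp add: norm_inverse inverse_less_1_iff)
    qed
    have "openin (top_of_set W) K'"
    proof -
      obtain V where V: "open V" "K = spectrum S \<inter> V" using K(3) by (auto simp: openin_open)
      \<comment> \<open>Inversion is continuous only away from 0, so 0 is removed before pulling
        \<open>V\<close> back.\<close>
      have "open (- {0} \<inter> inverse -` V :: complex set)"
        by (rule continuous_open_preimage[OF _ _ V(1)]) (auto intro!: continuous_intros)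
      moreover have "K' = W \<inter> (- {0} \<inter> inverse -` V)"
      proof (intro equalityI subsetI)
        fix w assume "w \<in> K'"
        then show "w \<in> W \<inter> (- {0} \<inter> inverse -` V)"
          using K'W K0 V(2) by (auto simp: K'_def)
      next
        fix w assume w: "w \<in> W \<inter> (- {0} \<inter> inverse -` V)"
        then have "inverse w \<in> K" using W V(2) by auto
        then have "inverse (inverse w) \<in> K'" unfolding K'_def by (rule imageI)
        then show "w \<in> K'" by simp
      qed
      ultimately show ?thesis by (auto simp: openin_open)
    qed
    then have K'cl: "closed (W - K')" by (rule closed_diff_relatively_open[OF clW])
    have K'ne: "K' \<noteq> {}" using K(2) by (simp add: K'_def)
    have comm: "id_blinfun o\<^sub>L S = S o\<^sub>L id_blinfun" by simp
    obtain T where T': "\<forall>n. clinear (blinfun_apply (T n))" "\<forall>n. id_blinfun o\<^sub>L T n = S o\<^sub>L T (Suc n)"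
      "\<forall>n. T n o\<^sub>L id_blinfun = id_blinfun o\<^sub>L T n" "\<forall>n. T n o\<^sub>L S = S o\<^sub>L T n"
      "T \<longlonglongrightarrow> 0" "S o\<^sub>L T 0 \<noteq> 0"
      by (rule pencil_moments[OF id S(1) comm K'c K'ne K'W[unfolded W_def] K'b K'cl[unfolded W_def]])
    note T = T'[rule_format]
    \<comment> \<open>The recursion now runs the other way:
      \<open>T n = S T (n+1) = T (n+1) S\<close>.\<close>
    have iter: "T 0 (free_dirac u) = T n (free_dirac ((f ^^ n) u))" for n u
    proof (induction n)
      case (Suc n)
      have "T n = T (Suc n) o\<^sub>L S" using T(2)[of n] T(4)[of "Suc n"] by simp
      then show ?case using Suc by (simp add: S)
    qed simp
    have "T 0 (free_dirac y) = 0" for y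
    proof (rule zero_on_free_dirac_if_recurrent[OF T(5)])
      \<comment> \<open>The two balls change roles: the orbit starts near \<open>y\<close> and
        arrives near the base point.\<close>
      fix e :: real and N :: nat assume "e > 0"
      then obtain m u where "m \<ge> N" "u \<in> ball y e" "(f ^^ m) u \<in> ball basepoint 1"
        using topologically_transitive_late[OF assms(5), of "ball y e" "ball basepoint 1" N] by auto
      then show "\<exists>m\<ge>N. \<exists>u v. dist v y < e \<and> dist u basepoint < 1 \<and> T 0 (free_dirac v) = T m (free_dirac u)"
        using iter by (intro exI[of _ m] conjI exI[of _ u] exI[of _ "(f ^^ m) u"]) (auto simp: dist_commute)
    qed
    with T(1) have "T 0 = 0" by (intro eq_zero_if_zero_on_free_dirac)
    then show False using T(6) by (simp add: linear_simps(3)[OF bounded_linear_blinfun_compose(1)])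
  qed
qed

end
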